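(* Let $\mathbb{K}$ be a field of characteristic zero. Let $D$ be a nonzero triangular derivation of $\mathbb{K}[x_1,\dots,x_n]$ and let $F\in\ker D$; let $\tau\in\mathrm{BA}_n(\mathbb{K})$ and $\alpha\in\mathrm{GL}_n(\mathbb{K})$. Then $\tau\alpha\exp(FD)$ is normally co-tame.
   Context: $\mathrm{GA}_n(\mathbb{K})$ is the group of polynomial automorphisms of $\mathbb{A}^n$ over $\mathbb{K}$. An element is written $\phi=(H_1,\dots,H_n)$ with $H_i\in\mathbb{K}[x_1,\dots,x_n]$; it acts on polynomials on the right by $(P)\phi=P(H_1,\dots,H_n)$, and products satisfy $(P)(\phi\psi)=((P)\phi)\psi$ (so $\phi\psi$ is the usual composition $\phi\circ\psi$ of polynomial maps). $\mathrm{GL}_n(\mathbb{K})$ is viewed as the group of linear automorphisms, $\mathrm{SL}_n(\mathbb{K})$ as those of determinant $1$. $\mathrm{SA}_n(\mathbb{K})$ is the subgroup of $\mathrm{GA}_n(\mathbb{K})$ of automorphisms with Jacobian determinant $1$. $\mathrm{BA}_n(\mathbb{K})$ is the group of triangular automorphisms $(a_1x_1+P_1,a_2x_2+P_2(x_1),\dots,a_nx_n+P_n(x_1,\dots,x_{n-1}))$ with $a_i\in\mathbb{K}^*$, $P_i\in\mathbb{K}[x_1,\dots,x_{i-1}]$. A triangular derivation is a $\mathbb{K}$-derivation $D$ of $\mathbb{K}[x_1,\dots,x_n]$ with $D(x_i)\in\mathbb{K}[x_1,\dots,x_{i-1}]$ for every $i$ (so $D(x_1)\in\mathbb{K}$).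 For $F\in\ker D$, the derivation $FD$ is locally nilpotent, and $\exp(FD)\in\mathrm{GA}_n(\mathbb{K})$ is the automorphism with $(P)\exp(FD)=\sum_{k\ge0}\frac{1}{k!}(FD)^k(P)$. For $H\subseteq\mathrm{SA}_n(\mathbb{K})$, $\langle H\rangle^S$ is the normal subgroup of $\mathrm{SA}_n(\mathbb{K})$ generated by $H$. $\mathrm{SLIN}_n(\mathbb{K})=\langle \mathrm{SL}_n(\mathbb{K})\rangle^S$. An element $\theta\in\mathrm{SA}_n(\mathbb{K})$ is normally co-tame if $\langle\theta\rangle^S\supseteq\mathrm{SLIN}_n(\mathbb{K})$.
   Formalization: It is additionally assumed that ταexp(FD) has Jacobian determinant 1 (so that it lies in SA_n, where normal co-tameness is defined) and, when n ≥ 2, that ταexp(FD) is not the identity (for which the claim is false, e.g. τ = α = id, F = 0). *)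

theory Defs
  imports
    "HOL-Analysis.Determinants"
    "HOL-Library.Poly_Mapping"
    "HOL-Algebra.Generated_Groups"
begin

text \<open>
  Polynomials over \<open>'k\<close> in variables indexed by \<open>'n\<close>. Wherever the order of the variables
  \<open>x\<^sub>1, \<dots>, x\<^sub>n\<close> matters, \<open>'n\<close> is a finite linearly ordered type, i.e. a copy of
  \<open>{1 < \<dots> < n}\<close> with \<open>n = CARD('n)\<close>.
\<close>

type_synonym ('n, 'k) mpoly = "('n \<Rightarrow>\<^sub>0 nat) \<Rightarrow>\<^sub>0 'k"

definition Const :: "'k::comm_ring_1 \<Rightarrow> ('n, 'k) mpoly" where
  "Const c = Poly_Mapping.single 0 c"

definition Var :: "'n \<Rightarrow> ('n, 'k::comm_ring_1) mpoly" where
  "Var i = Poly_Mapping.single (Poly_Mapping.single i 1) 1"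

definition polys_in :: "'n set \<Rightarrow> ('n, 'k::comm_ring_1) mpoly set" where
  "polys_in S = {P. \<forall>m \<in> Poly_Mapping.keys P. Poly_Mapping.keys m \<subseteq> S}"

definition pderiv_var :: "'n \<Rightarrow> ('n, 'k::comm_ring_1) mpoly \<Rightarrow> ('n, 'k) mpoly" where
  "pderiv_var i P =
     (\<Sum>m\<in>Poly_Mapping.keys P. Poly_Mapping.single (m - Poly_Mapping.single i 1)
        (of_nat (Poly_Mapping.lookup m i) * Poly_Mapping.lookup P m))"


text \<open>
  A polynomial map is the tuple of its components \<open>H i = (x\<^sub>i)H\<close>; \<open>act P H\<close> is \<open>(P)H\<close>.
\<close>

type_synonym ('n, 'k) pmap = "'n \<Rightarrow> ('n, 'k) mpoly"

definition act :: "('n::finite, 'k::comm_ring_1) mpoly \<Rightarrow> ('n, 'k) pmap \<Rightarrow> ('n, 'k) mpoly" where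
  "act P H =
     (\<Sum>m\<in>Poly_Mapping.keys P.
        Const (Poly_Mapping.lookup P m) * (\<Prod>i\<in>UNIV. H i ^ Poly_Mapping.lookup m i))"

text \<open>The product is determined by \<open>(x\<^sub>i)(\<phi>\<psi>) = ((x\<^sub>i)\<phi>)\<psi>\<close>.\<close>

definition pmap_monoid :: "('n::finite, 'k::comm_ring_1) pmap monoid" where
  "pmap_monoid = \<lparr>carrier = UNIV, mult = (\<lambda>\<phi> \<psi> i. act (\<phi> i) \<psi>), one = Var\<rparr>"

definition GA :: "('n::finite, 'k::comm_ring_1) pmap monoid" where
  "GA = units_of pmap_monoid"

definition jac_det :: "('n::finite, 'k::comm_ring_1) pmap \<Rightarrow> ('n, 'k) mpoly" where
  "jac_det H = det (\<chi> i j. pderiv_var j (H i))"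

definition SA :: "('n::finite, 'k::comm_ring_1) pmap monoid" where
  "SA = GA\<lparr>carrier := {\<phi> \<in> carrier GA. jac_det \<phi> = 1}\<rparr>"

definition linear_pmap :: "'k::comm_ring_1^'n^'n \<Rightarrow> ('n::finite, 'k) pmap" where
  "linear_pmap A = (\<lambda>i. \<Sum>j\<in>UNIV. Const (A $ i $ j) * Var j)"

definition GL :: "('n::finite, 'k::field) pmap set" where
  "GL = {linear_pmap A | A. det A \<noteq> 0}"

definition SL :: "('n::finite, 'k::field) pmap set" where
  "SL = {linear_pmap A | A. det A = 1}"

definition BA :: "('n::{finite,linorder}, 'k::field) pmap set" where
  "BA = {\<phi>. \<forall>i. \<exists>a P. a \<noteq> 0 \<and> P \<in> polys_in {..<i} \<and> \<phi> i = Const a * Var i + P}"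


definition derivation :: "(('n, 'k::comm_ring_1) mpoly \<Rightarrow> ('n, 'k) mpoly) \<Rightarrow> bool" where
  "derivation D \<longleftrightarrow>
     (\<forall>P Q. D (P + Q) = D P + D Q) \<and>
     (\<forall>c P. D (Const c * P) = Const c * D P) \<and>
     (\<forall>P Q. D (P * Q) = D P * Q + P * D Q)"

definition triangular_derivation ::
    "(('n::linorder, 'k::comm_ring_1) mpoly \<Rightarrow> ('n, 'k) mpoly) \<Rightarrow> bool" where
  "triangular_derivation D \<longleftrightarrow> derivation D \<and> (\<forall>i. D (Var i) \<in> polys_in {..<i})"

text \<open>
  The exponential of a locally nilpotent derivation \<open>E\<close>. All but finitely many terms of the
  series vanish, so it is a \<^const>\<open>Sum_any\<close>; the automorphism is recorded by the images
  of the variables.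
\<close>

definition exp_series ::
    "(('n, 'k::field_char_0) mpoly \<Rightarrow> ('n, 'k) mpoly) \<Rightarrow> ('n, 'k) mpoly \<Rightarrow> ('n, 'k) mpoly" where
  "exp_series E P = Sum_any (\<lambda>k. Const (inverse (fact k)) * (E ^^ k) P)"

definition exp_aut ::
    "(('n, 'k::field_char_0) mpoly \<Rightarrow> ('n, 'k) mpoly) \<Rightarrow> ('n, 'k) pmap" where
  "exp_aut E = (\<lambda>i. exp_series E (Var i))"


definition normal_closure :: "('a, 'b) monoid_scheme \<Rightarrow> 'a set \<Rightarrow> 'a set" where
  "normal_closure G H =
     generate G {g \<otimes>\<^bsub>G\<^esub> h \<otimes>\<^bsub>G\<^esub> inv\<^bsub>G\<^esub> g | g h. g \<in> carrier G \<and> h \<in> H}"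

definition SLIN :: "('n::finite, 'k::field) pmap set" where
  "SLIN = normal_closure SA SL"

definition normally_cotame :: "('n::finite, 'k::field) pmap \<Rightarrow> bool" where
  "normally_cotame \<theta> \<longleftrightarrow> \<theta> \<in> carrier SA \<and> SLIN \<subseteq> normal_closure SA {\<theta>}"

end

(*
  Write exp(G D) for the flows of D, and let e_n be the direction of the last variable. Put
  beta = tau alpha, epsilon = exp(F D) and theta = beta epsilon. Triangularity of tau gives a
  vector v such that beta conjugates the translations along v to those along e_n. Let N be the
  normal closure of theta.

  (1) If some x <> 1 in N commutes with all translations along some u <> 0, then N contains SL:
  commutators of x with shears along u are again shears along u, so N contains a nontrivial
  shear; taking differences one reaches a translation, then all translations along the axes and
  the transvections.

  (2) Suppose N does not contain SL, and let G be killed by D and d/dx_n. Then rho = exp(G D)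
  commutes with epsilon and with the translations t along e_n. If s is the translation along v
  with beta s = t beta, then [rho, s] lies in N and commutes with the translations along e_n,
  so it is trivial by (1). Hence rho beta^-1 rho^-1 beta, which lies in N, commutes with s and
  is trivial as well. Differentiating, D commutes with d/dv and with beta, and every such G is
  killed by d/dv and fixed by beta.

  (3) If v is parallel to e_n, induct on the degree of F in x_n, commuting theta with
  translations along e_n. Otherwise (2) has enough elements G to force D = f d/dv + p d/dx_n
  with f and p among the G. If p = 0, theta conjugates the translation along v to the one along
  e_n, which puts a translation into N. If p <> 0, applying beta shows f = p k with k a unit,
  hence a constant; then theta commutes with the translations along k v + e_n, and (1) applies.
*)

theory Submission
  imports Defs "HOL-Computational_Algebra.Polynomial"
begin

subsection \<open>Polynomials\<close>

lemma Const_0 [simp]: "Const 0 = 0"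
  by (simp add: Const_def)

lemma Const_1 [simp]: "Const 1 = 1"
  by (simp add: Const_def)

lemma Const_add: "Const (a + b) = Const a + Const b"
  by (simp add: Const_def single_add)

lemma Const_uminus: "Const (- a) = - Const a"
  by (simp add: Const_def single_uminus)

lemma Const_mult: "Const (a * b) = Const a * Const b"
  by (simp add: Const_def mult_single)

lemma Const_sum: "Const (\<Sum>x\<in>A. f x) = (\<Sum>x\<in>A. Const (f x))"
  by (induction A rule: infinite_finite_induct) (simp_all add: Const_add)

lemma Const_power: "Const (a ^ n) = Const a ^ n"
  by (induction n) (simp_all add: Const_mult)

lemma Const_of_nat: "Const (of_nat n) = of_nat n"
  by (induction n) (simp_all add: Const_add)

lemma lookup_Const_0 [simp]: "Poly_Mapping.lookup (Const a) 0 = a"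
  by (simp add: Const_def)

lemma Const_eq_iff [simp]: "Const a = Const b \<longleftrightarrow> a = b"
  by (metis lookup_Const_0)

lemma Const_eq_0_iff [simp]: "Const a = 0 \<longleftrightarrow> a = 0"
  by (metis Const_0 Const_eq_iff)

lemma poly_mapping_sum_single:
  "(\<Sum>x\<in>Poly_Mapping.keys f. Poly_Mapping.single x (Poly_Mapping.lookup f x)) = f"
  by (rule poly_mapping_eqI)
    (auto simp: lookup_sum lookup_single when_def in_keys_iff sum.If_cases)

lemma monomial_eq: "Poly_Mapping.single m c = Const c * (\<Prod>i\<in>Poly_Mapping.keys m. Var i ^ Poly_Mapping.lookup m i)"
proof -
  have pow: "Poly_Mapping.single (Poly_Mapping.single i k) 1 = Var i ^ k" for i and k :: nat
  proof (induction k)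
    case (Suc k)
    have "Poly_Mapping.single (Poly_Mapping.single i (Suc k)) 1 =
        Var i * Poly_Mapping.single (Poly_Mapping.single i k) 1"
      by (simp add: Var_def mult_single single_add[symmetric])
    then show ?case using Suc by (metis power_Suc)
  qed simp
  have "Poly_Mapping.single (\<Sum>i\<in>S. Poly_Mapping.single i (Poly_Mapping.lookup m i)) 1 =
      (\<Prod>i\<in>S. Var i ^ Poly_Mapping.lookup m i :: ('a, 'b) mpoly)" if "finite S" for S
    using that
  proof (induction S rule: finite_induct)
    case (insert x S)
    have "Poly_Mapping.single (\<Sum>i\<in>insert x S. Poly_Mapping.single i (Poly_Mapping.lookup m i)) (1::'b) =
       Poly_Mapping.single (Poly_Mapping.single x (Poly_Mapping.lookup m x)) 1 *
       Poly_Mapping.single (\<Sum>i\<in>S. Poly_Mapping.single i (Poly_Mapping.lookup m i)) 1"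
      by (simp only: sum.insert[OF insert.hyps] mult_single mult_1)
    then show ?case by (simp only: pow insert.IH prod.insert[OF insert.hyps])
  qed simp
  from this[of "Poly_Mapping.keys m"]
  have "Poly_Mapping.single m 1 = (\<Prod>i\<in>Poly_Mapping.keys m. Var i ^ Poly_Mapping.lookup m i :: ('a, 'b) mpoly)"
    by (simp add: poly_mapping_sum_single)
  then show ?thesis
    using mult_single[of 0 c m 1] by (simp add: Const_def)
qed

text \<open>The constants and the variables in \<open>S\<close> generate \<open>polys_in S\<close>
  as a ring. Through this rule an identity between homomorphisms or between derivations only needs
  checking on variables.\<close>

lemma polys_in_induct [consumes 1, case_names Const Var add mult]:
  fixes P :: "('n, 'k::comm_ring_1) mpoly"
  assumes P: "P \<in> polys_in S"
    and const: "\<And>c. X (Const c)" and var: "\<And>i. i \<in> S \<Longrightarrow> X (Var i)"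
    and add: "\<And>p q. X p \<Longrightarrow> X q \<Longrightarrow> X (p + q)" and mult: "\<And>p q. X p \<Longrightarrow> X q \<Longrightarrow> X (p * q)"
  shows "X P"
proof -
  have X0: "X 0" and X1: "X 1" using const[of 0] const[of 1] by simp_all
  have pow: "X (Var i ^ k)" if "i \<in> S" for i k
    by (induction k) (use X1 mult var that in auto)
  have mon: "X (\<Prod>i\<in>T. Var i ^ f i)" if "finite T" "T \<subseteq> S" for T and f :: "'n \<Rightarrow> nat"
    using that by (induction T rule: finite_induct) (auto intro!: X1 mult pow)
  have "X (\<Sum>m\<in>M. Poly_Mapping.single m (Poly_Mapping.lookup P m))" if "finite M" "M \<subseteq> Poly_Mapping.keys P" for M
    using that
  proof (induction M rule: finite_induct)
    case (insert m M)
    then have "Poly_Mapping.keys m \<subseteq> S" using P by (auto simp: polys_in_def)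
    then have "X (Poly_Mapping.single m (Poly_Mapping.lookup P m))"
      unfolding monomial_eq by (intro mult const mon) auto
    then show ?case using insert by (simp add: add)
  qed (use X0 in auto)
  from this[of "Poly_Mapping.keys P"] show ?thesis by (simp add: poly_mapping_sum_single)
qed

lemma polys_in_UNIV [simp]: "P \<in> polys_in UNIV"
  by (simp add: polys_in_def)

lemmas mpoly_induct [case_names Const Var add mult] = polys_in_induct[OF polys_in_UNIV]

lemma polys_in_mono: "S \<subseteq> T \<Longrightarrow> polys_in S \<subseteq> polys_in T"
  by (auto simp: polys_in_def)

lemma polys_in_Const [simp, intro]: "Const c \<in> polys_in S"
  by (auto simp: polys_in_def Const_def)

lemma polys_in_0 [simp, intro]: "0 \<in> polys_in S"
  by (auto simp: polys_in_def)

lemma polys_in_1 [simp, intro]: "1 \<in> polys_in S"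
  by (metis Const_1 polys_in_Const)

lemma polys_in_Var: "i \<in> S \<Longrightarrow> Var i \<in> polys_in S"
  by (auto simp: polys_in_def Var_def)

lemma polys_in_add: "P \<in> polys_in S \<Longrightarrow> Q \<in> polys_in S \<Longrightarrow> P + Q \<in> polys_in S"
  using Poly_Mapping.keys_add[of P Q] by (fastforce simp: polys_in_def)

lemma keys_add_nat: "Poly_Mapping.keys (a + b :: 'n \<Rightarrow>\<^sub>0 nat) = Poly_Mapping.keys a \<union> Poly_Mapping.keys b"
  by (auto simp: in_keys_iff lookup_add)

lemma polys_in_mult: "P \<in> polys_in S \<Longrightarrow> Q \<in> polys_in S \<Longrightarrow> P * Q \<in> polys_in S"
  using keys_mult[of P Q] by (fastforce simp: polys_in_def keys_add_nat)

lemma polys_in_uminus: "P \<in> polys_in S \<Longrightarrow> - P \<in> polys_in S"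
  by (auto simp: polys_in_def)

lemma polys_in_diff: "P \<in> polys_in S \<Longrightarrow> Q \<in> polys_in S \<Longrightarrow> P - Q \<in> polys_in S"
  using polys_in_add[of P S "- Q"] polys_in_uminus[of Q S] by simp

lemma polys_in_power: "P \<in> polys_in S \<Longrightarrow> P ^ n \<in> polys_in S"
  by (induction n) (simp_all add: polys_in_mult)

lemmas polys_in_intros = polys_in_Const polys_in_Var polys_in_add polys_in_mult polys_in_uminus
  polys_in_diff polys_in_power

subsection \<open>Substitution\<close>

lemma act_superset:
  assumes "finite K" "Poly_Mapping.keys P \<subseteq> K"
  shows "act P H = (\<Sum>m\<in>K. Const (Poly_Mapping.lookup P m) * (\<Prod>i\<in>UNIV. H i ^ Poly_Mapping.lookup m i))"
  unfolding act_def by (rule sum.mono_neutral_left) (use assms in \<open>auto simp: in_keys_iff\<close>)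

lemma act_add: "act (P + Q) H = act P H + act Q H"
proof -
  let ?K = "Poly_Mapping.keys P \<union> Poly_Mapping.keys Q"
  show ?thesis
    using Poly_Mapping.keys_add[of P Q]
    by (simp add: act_superset[of ?K] lookup_add Const_add distrib_right sum.distrib)
qed

lemma act_0 [simp]: "act 0 H = 0"
  by (simp add: act_def)

lemma act_uminus: "act (- P) H = - act P H"
  by (metis act_0 act_add add.right_inverse add_eq_0_iff)

lemma act_diff: "act (P - Q) H = act P H - act Q H"
  using act_add[of P "- Q" H] by (simp add: act_uminus)

lemma act_sum: "act (\<Sum>x\<in>A. f x) H = (\<Sum>x\<in>A. act (f x) H)"
  by (induction A rule: infinite_finite_induct) (simp_all add: act_add)

lemma act_single: "act (Poly_Mapping.single m c) H = Const c * (\<Prod>i\<in>UNIV. H i ^ Poly_Mapping.lookup m i)"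
  by (cases "c = 0") (simp_all add: act_def)

lemma act_mult: "act (P * Q) H = act P H * act Q H"
proof -
  have mon: "act (Poly_Mapping.single m a * Poly_Mapping.single m' b) H =
      act (Poly_Mapping.single m a) H * act (Poly_Mapping.single m' b) H" for m m' a b
    by (simp add: mult_single act_single Const_mult lookup_add power_add prod.distrib mult_ac)
  have "act (P * Q) H = act ((\<Sum>m\<in>Poly_Mapping.keys P. Poly_Mapping.single m (Poly_Mapping.lookup P m)) *
     (\<Sum>m\<in>Poly_Mapping.keys Q. Poly_Mapping.single m (Poly_Mapping.lookup Q m))) H"
    by (simp only: poly_mapping_sum_single)
  also have "\<dots> = act (\<Sum>m\<in>Poly_Mapping.keys P. Poly_Mapping.single m (Poly_Mapping.lookup P m)) H *
     act (\<Sum>m\<in>Poly_Mapping.keys Q. Poly_Mapping.single m (Poly_Mapping.lookup Q m)) H"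
    by (simp only: sum_product act_sum mon)
  finally show ?thesis by (simp only: poly_mapping_sum_single)
qed

lemma act_Const [simp]: "act (Const c) H = Const c"
  by (simp add: Const_def act_single)

lemma act_1 [simp]: "act 1 H = 1"
  by (metis Const_1 act_Const)

lemma act_Var [simp]: "act (Var i) H = H i"
proof -
  have "(\<Prod>j\<in>UNIV. H j ^ Poly_Mapping.lookup (Poly_Mapping.single i 1) j) = (\<Prod>j\<in>UNIV. if j = i then H j else 1)"
    by (intro prod.cong) (auto simp: lookup_single)
  then show ?thesis by (simp add: Var_def act_single)
qed

lemma act_power: "act (P ^ n) H = act P H ^ n"
  by (induction n) (simp_all add: act_mult)

lemma act_prod: "act (\<Prod>x\<in>A. f x) H = (\<Prod>x\<in>A. act (f x) H)"
  by (induction A rule: infinite_finite_induct) (simp_all add: act_mult)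

lemmas act_simps = act_add act_mult act_diff act_uminus act_sum act_power act_prod

text \<open>An algebra homomorphism is determined by its values on the variables. Flows become
  polynomial maps this way.\<close>

lemma act_unique:
  assumes "\<And>c. \<phi> (Const c) = Const c" "\<And>p q. \<phi> (p + q) = \<phi> p + \<phi> q" "\<And>p q. \<phi> (p * q) = \<phi> p * \<phi> q"
  shows "\<phi> P = act P (\<lambda>i. \<phi> (Var i))"
  by (induction P rule: mpoly_induct) (simp_all add: assms act_simps)

lemma act_ident [simp]: "act P Var = P"
  using act_unique[of "\<lambda>P. P" P] by metis

lemma act_act: "act (act P \<phi>) \<psi> = act P (\<lambda>i. act (\<phi> i) \<psi>)"
  using act_unique[of "\<lambda>P. act (act P \<phi>) \<psi>"] by (simp add: act_simps)

subsection \<open>Derivations\<close>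

lemma derivationD:
  assumes "derivation D"
  shows "D (P + Q) = D P + D Q" "D (Const c * P) = Const c * D P" "D (P * Q) = D P * Q + P * D Q"
    "D (Const c) = 0" "D 0 = 0" "D 1 = 0" "D (- P) = - D P" "D (P - Q) = D P - D Q"
proof -
  note D = assms[unfolded derivation_def]
  show add: "D (P + Q) = D P + D Q" and "D (Const c * P) = Const c * D P" "D (P * Q) = D P * Q + P * D Q" for P Q c
    using D by blast+
  show D0: "D 0 = 0" using D by (metis add_cancel_right_right)
  have "D (1 * 1) = D 1 * 1 + 1 * D 1" using D by blast
  then show D1: "D 1 = 0" by simp
  have "D (Const c * 1) = Const c * D 1" using D by blast
  then show "D (Const c) = 0" using D1 by simp
  show neg: "D (- P) = - D P" for P using add[of P "- P"] D0 by (simp add: eq_neg_iff_add_eq_0 add.commute)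
  show "D (P - Q) = D P - D Q" using add[of P "- Q"] neg by simp
qed

lemma derivation_sum:
  assumes "derivation D" shows "D (\<Sum>x\<in>A. f x) = (\<Sum>x\<in>A. D (f x))"
  by (induction A rule: infinite_finite_induct) (simp_all add: derivationD[OF assms])

lemma derivation_power:
  assumes "derivation D" shows "D (P ^ Suc n) = of_nat (Suc n) * P ^ n * D P"
proof (induction n)
  case (Suc n)
  have "D (P ^ Suc (Suc n)) = D P * P ^ Suc n + P * (of_nat (Suc n) * P ^ n * D P)"
    unfolding power_Suc[of P "Suc n"] derivationD(3)[OF assms] Suc ..
  then show ?case by (simp add: algebra_simps)
qed simp

lemma derivation_power_eq_0:
  assumes "derivation D" "D P = 0" shows "D (P ^ n) = 0"
  by (cases n) (simp_all only: derivation_power[OF assms(1)] derivationD[OF assms(1)] assms(2) mult_zero_right power_0)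

lemma derivation_eqI:
  assumes "derivation D" "derivation E" "P \<in> polys_in S" "\<And>i. i \<in> S \<Longrightarrow> D (Var i) = E (Var i)"
  shows "D P = E P"
  using assms(3)
  by (induction P rule: polys_in_induct) (simp_all add: derivationD[OF assms(1)] derivationD[OF assms(2)] assms(4))

lemma derivation_eq_0I:
  assumes "derivation D" "P \<in> polys_in S" "\<And>i. i \<in> S \<Longrightarrow> D (Var i) = 0"
  shows "D P = 0"
  using assms(2)
  by (induction P rule: polys_in_induct) (simp_all add: derivationD[OF assms(1)] assms(3))

section \<open>Formal partial derivatives and the chain rule\<close>

lemma pderiv_var_superset:
  assumes "finite K" "Poly_Mapping.keys P \<subseteq> K"
  shows "pderiv_var i P = (\<Sum>m\<in>K. Poly_Mapping.single (m - Poly_Mapping.single i 1)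
        (of_nat (Poly_Mapping.lookup m i) * Poly_Mapping.lookup P m))"
  unfolding pderiv_var_def by (rule sum.mono_neutral_left) (use assms in \<open>auto simp: in_keys_iff\<close>)

lemma pderiv_var_add: "pderiv_var i (P + Q) = pderiv_var i P + pderiv_var i Q"
proof -
  let ?K = "Poly_Mapping.keys P \<union> Poly_Mapping.keys Q"
  show ?thesis
    using Poly_Mapping.keys_add[of P Q]
    by (simp add: pderiv_var_superset[of ?K] lookup_add distrib_left single_add sum.distrib)
qed

lemma pderiv_var_0 [simp]: "pderiv_var i 0 = 0"
  by (simp add: pderiv_var_def)

lemma pderiv_var_sum: "pderiv_var i (\<Sum>x\<in>A. f x) = (\<Sum>x\<in>A. pderiv_var i (f x))"
  by (induction A rule: infinite_finite_induct) (simp_all add: pderiv_var_add)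

lemma pderiv_var_single: "pderiv_var i (Poly_Mapping.single m c) =
    Poly_Mapping.single (m - Poly_Mapping.single i 1) (of_nat (Poly_Mapping.lookup m i) * c)"
  by (cases "c = 0") (simp_all add: pderiv_var_def)

lemma single_diff_add:
  assumes "Poly_Mapping.lookup m i \<noteq> (0::nat)"
  shows "m - Poly_Mapping.single i 1 + m' = m + m' - Poly_Mapping.single i 1"
  by (rule poly_mapping_eqI) (use assms in \<open>auto simp: lookup_add lookup_minus lookup_single when_def\<close>)

lemma pderiv_var_mult: "pderiv_var i (P * Q) = pderiv_var i P * Q + P * pderiv_var i Q"
proof -
  let ?s = "\<lambda>P m. Poly_Mapping.single m (Poly_Mapping.lookup P m)"
  have mon: "pderiv_var i (Poly_Mapping.single m a * Poly_Mapping.single m' b) =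
      pderiv_var i (Poly_Mapping.single m a) * Poly_Mapping.single m' b +
      Poly_Mapping.single m a * pderiv_var i (Poly_Mapping.single m' b)" for m m' and a b :: 'b
  proof -
    have "pderiv_var i (Poly_Mapping.single m a) * Poly_Mapping.single m' b =
        Poly_Mapping.single (m + m' - Poly_Mapping.single i 1) (of_nat (Poly_Mapping.lookup m i) * a * b)" for m m' and a b :: 'b
      by (cases "Poly_Mapping.lookup m i = 0")
        (simp_all add: pderiv_var_single mult_single single_diff_add[unfolded One_nat_def])
    from this[of m a m' b] this[of m' b m a] show ?thesis
      by (simp add: pderiv_var_single mult_single lookup_add algebra_simps single_add)
  qed
  have "pderiv_var i (P * Q) = pderiv_var i ((\<Sum>m\<in>Poly_Mapping.keys P. ?s P m) * (\<Sum>m\<in>Poly_Mapping.keys Q. ?s Q m))"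
    by (simp only: poly_mapping_sum_single)
  also have "\<dots> = pderiv_var i (\<Sum>m\<in>Poly_Mapping.keys P. ?s P m) * (\<Sum>m\<in>Poly_Mapping.keys Q. ?s Q m)
       + (\<Sum>m\<in>Poly_Mapping.keys P. ?s P m) * pderiv_var i (\<Sum>m\<in>Poly_Mapping.keys Q. ?s Q m)"
    by (simp only: sum_product pderiv_var_sum mon sum.distrib)
  finally show ?thesis by (simp only: poly_mapping_sum_single)
qed

lemma derivation_pderiv_var: "derivation (pderiv_var i)"
proof -
  have "pderiv_var i (Const c) = 0" for c :: 'b
    by (simp add: Const_def pderiv_var_single)
  then show ?thesis
    by (simp add: derivation_def pderiv_var_add pderiv_var_mult)
qed

lemma pderiv_var_Var: "pderiv_var i (Var j) = (if i = j then 1 else 0)"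
  by (auto simp: Var_def pderiv_var_single lookup_single)

lemma derivation_act:
  assumes "derivation D"
  shows "D (act P H) = (\<Sum>k\<in>UNIV. act (pderiv_var k P) H * D (H k))"
proof (induction P rule: mpoly_induct)
  case (Var i)
  have "(\<Sum>k\<in>UNIV. act (pderiv_var k (Var i)) H * D (H k)) = (\<Sum>k\<in>UNIV. if k = i then D (H k) else 0)"
    by (intro sum.cong) (auto simp: pderiv_var_Var)
  then show ?case by simp
next
  case (mult p q)
  have "D (act (p * q) H) = (\<Sum>k\<in>UNIV. act (pderiv_var k p) H * D (H k)) * act q H
      + act p H * (\<Sum>k\<in>UNIV. act (pderiv_var k q) H * D (H k))"
    by (simp only: act_mult derivationD(3)[OF assms] mult)
  also have "\<dots> = (\<Sum>k\<in>UNIV. act (pderiv_var k (p * q)) H * D (H k))"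
    unfolding sum_distrib_left sum_distrib_right sum.distrib[symmetric]
    by (intro sum.cong refl) (simp add: pderiv_var_mult act_simps algebra_simps)
  finally show ?case .
next
  case (Const c)
  show ?case by (simp add: derivationD(4)[OF assms] derivationD(4)[OF derivation_pderiv_var])
next
  case (add p q)
  then show ?case
    by (simp add: act_add derivationD(1)[OF assms] pderiv_var_add distrib_right sum.distrib)
qed

subsection \<open>Flows of locally nilpotent derivations\<close>

definition lnd :: "(('n, 'k::comm_ring_1) mpoly \<Rightarrow> ('n, 'k) mpoly) \<Rightarrow> bool" where
  "lnd D \<longleftrightarrow> derivation D \<and> (\<forall>P. \<exists>k. (D ^^ k) P = 0)"

lemma lnd_derivation: "lnd D \<Longrightarrow> derivation D"
  by (simp add: lnd_def)

lemma funpow_derivation: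
  assumes "derivation D"
  shows "(D ^^ k) (P + Q) = (D ^^ k) P + (D ^^ k) Q" "(D ^^ k) (Const c * P) = Const c * (D ^^ k) P" "(D ^^ k) 0 = 0"
  by (induction k) (simp_all add: derivationD[OF assms])

lemma funpow_eq_0_mono:
  assumes "derivation D" "(D ^^ k) P = 0" "k \<le> l" shows "(D ^^ l) P = 0"
proof -
  have "(D ^^ (l - k + k)) P = 0"
    unfolding funpow_add by (simp add: assms(2) funpow_derivation[OF assms(1)])
  then show ?thesis using assms(3) by simp
qed

text \<open>By the Leibniz rule one application of \<open>D\<close> lowers the exponent needed for
  one of the two factors, hence induction on \<open>a + b\<close>.\<close>

lemma funpow_mult_eq_0:
  assumes "derivation D"
  shows "(D ^^ a) P = 0 \<Longrightarrow> (D ^^ b) Q = 0 \<Longrightarrow> (D ^^ (a + b)) (P * Q) = 0"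
proof (induction "a + b" arbitrary: a b P Q)
  case (Suc n)
  show ?case
  proof (cases "a = 0 \<or> b = 0")
    case True
    then show ?thesis using Suc.prems by (auto simp: funpow_derivation[OF assms])
  next
    case False
    then obtain a' b' where ab: "a = Suc a'" "b = Suc b'" by (metis not0_implies_Suc)
    have "(D ^^ (a' + b)) (D P * Q) = 0"
      using Suc.hyps Suc.prems ab by (intro Suc.hyps(1)) (auto simp: funpow_swap1)
    moreover have "(D ^^ (a + b')) (P * D Q) = 0"
      using Suc.hyps Suc.prems ab by (intro Suc.hyps(1)) (auto simp: funpow_swap1)
    moreover have "(D ^^ (a + b)) (P * Q) = (D ^^ (a' + b)) (D (P * Q))"
      by (simp add: ab funpow_swap1)
    ultimately show ?thesis
      by (simp add: ab derivationD[OF assms] funpow_derivation[OF assms])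
  qed
qed simp

lemma derivation_nilpotent_on:
  assumes "derivation D" "P \<in> polys_in S" "\<And>i. i \<in> S \<Longrightarrow> \<exists>k. (D ^^ k) (Var i) = 0"
  shows "\<exists>k. (D ^^ k) P = 0"
  using assms(2)
proof (induction P rule: polys_in_induct)
  case (Const c)
  have "(D ^^ 1) (Const c) = 0" by (simp add: derivationD[OF assms(1)])
  then show ?case by blast
next
  case (add p q)
  then obtain a b where "(D ^^ a) p = 0" "(D ^^ b) q = 0" by blast
  then have "(D ^^ (a + b)) (p + q) = 0"
    by (simp add: funpow_derivation[OF assms(1)] funpow_eq_0_mono[OF assms(1)])
  then show ?case by blast
next
  case (mult p q)
  then show ?case using funpow_mult_eq_0[OF assms(1)] by blast
qed (use assms in auto)

lemma lndI:
  assumes "derivation D" "\<And>i. \<exists>k. (D ^^ k) (Var i) = 0"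
  shows "lnd D"
  using derivation_nilpotent_on[OF assms(1) polys_in_UNIV] assms by (auto simp: lnd_def)

text \<open>Dividing by the factorial removes the binomial coefficients from the Leibniz rule
  (\<open>div_pow_mult\<close>), which makes the generating polynomial of these powers
  multiplicative in \<open>P\<close>.\<close>

definition div_pow :: "(('n, 'k::field_char_0) mpoly \<Rightarrow> ('n, 'k) mpoly) \<Rightarrow> nat \<Rightarrow> ('n, 'k) mpoly \<Rightarrow> ('n, 'k) mpoly" where
  "div_pow D k P = Const (inverse (fact k)) * (D ^^ k) P"

lemma div_pow_0 [simp]: "div_pow D 0 P = P"
  by (simp add: div_pow_def)

lemma div_pow_1 [simp]: "div_pow D (Suc 0) P = D P"
  by (simp add: div_pow_def)

lemma div_pow_add: "derivation D \<Longrightarrow> div_pow D k (P + Q) = div_pow D k P + div_pow D k Q"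
  by (simp add: div_pow_def funpow_derivation distrib_left)

lemma div_pow_Const: "derivation D \<Longrightarrow> div_pow D k (Const c) = (if k = 0 then Const c else 0)"
  by (cases k) (simp_all add: div_pow_def funpow_derivation funpow_swap1 derivationD)

lemma div_pow_Suc: "derivation D \<Longrightarrow> D (div_pow D k P) = Const (of_nat (Suc k)) * div_pow D (Suc k) P"
proof -
  assume D: "derivation D"
  have "(of_nat (Suc k) :: 'b) * inverse (fact (Suc k)) = inverse (fact k)"
    by (simp add: field_simps del: of_nat_Suc)
  then show ?thesis
    by (simp add: div_pow_def derivationD[OF D] mult.assoc[symmetric] Const_mult[symmetric] del: of_nat_Suc)
qed

lemma div_pow_div_pow:
  assumes "derivation D"
  shows "div_pow D l (div_pow D k P) = Const (of_nat ((k + l) choose k)) * div_pow D (k + l) P"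
proof -
  have "inverse (fact l) * inverse (fact k) = (of_nat ((k + l) choose k) :: 'b) * inverse (fact (k + l))"
    by (simp add: binomial_fact field_simps)
  then show ?thesis
    by (simp add: div_pow_def funpow_derivation[OF assms] mult.assoc[symmetric] Const_mult[symmetric]
        funpow_add[symmetric, THEN fun_cong, unfolded comp_def] add.commute)
qed

lemma div_pow_mult:
  assumes "derivation D"
  shows "div_pow D k (P * Q) = (\<Sum>i\<le>k. div_pow D i P * div_pow D (k - i) Q)"
proof (induction k)
  case (Suc k)
  let ?t = "\<lambda>i. div_pow D i P * div_pow D (Suc k - i) Q"
  \<comment> \<open>Applying \<open>D\<close> to the induction hypothesis gives \<open>Suc k\<close>
    times the claim: the weights \<open>i\<close> and \<open>Suc k - i\<close> add up to
    \<open>Suc k\<close>, which is invertible in characteristic zero.\<close>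
  have "Const (of_nat (Suc k)) * div_pow D (Suc k) (P * Q) = D (\<Sum>i\<le>k. div_pow D i P * div_pow D (k - i) Q)"
    by (simp only: div_pow_Suc[OF assms, symmetric] Suc)
  also have "\<dots> = (\<Sum>i\<le>k. Const (of_nat (Suc i)) * ?t (Suc i)) + (\<Sum>i\<le>k. Const (of_nat (Suc k - i)) * ?t i)"
    by (simp add: derivation_sum[OF assms] derivationD(3)[OF assms] div_pow_Suc[OF assms] sum.distrib
        mult_ac Suc_diff_le del: of_nat_Suc)
  also have "(\<Sum>i\<le>k. Const (of_nat (Suc i)) * ?t (Suc i)) = (\<Sum>i\<le>Suc k. Const (of_nat i) * ?t i)"
    by (subst sum.atMost_Suc_shift) simp
  also have "(\<Sum>i\<le>k. Const (of_nat (Suc k - i)) * ?t i) = (\<Sum>i\<le>Suc k. Const (of_nat (Suc k - i)) * ?t i)"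
    by simp
  also have "(\<Sum>i\<le>Suc k. Const (of_nat i) * ?t i) + \<dots> = (\<Sum>i\<le>Suc k. Const (of_nat (Suc k)) * ?t i)"
    unfolding sum.distrib[symmetric] distrib_right[symmetric] Const_add[symmetric] of_nat_add[symmetric]
    by (intro sum.cong) auto
  finally have "Const (inverse (of_nat (Suc k))) * (Const (of_nat (Suc k)) * div_pow D (Suc k) (P * Q)) =
      Const (inverse (of_nat (Suc k))) * (Const (of_nat (Suc k)) * (\<Sum>i\<le>Suc k. ?t i))"
    by (simp only: sum_distrib_left)
  then show ?case
    by (simp add: mult.assoc[symmetric] Const_mult[symmetric] del: of_nat_Suc sum.atMost_Suc)
qed simp

text \<open>This is \<open>exp(t D) P\<close> as a polynomial in the time \<open>t\<close>; for
  locally nilpotent \<open>D\<close> only finitely many coefficients are nonzero. The flow below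
  puts \<open>t = F\<close>: a ring homomorphism for every \<open>F\<close>, and
  \<open>exp(F D)\<close> if \<open>D F = 0\<close>.\<close>

definition flow_poly :: "(('n, 'k::field_char_0) mpoly \<Rightarrow> ('n, 'k) mpoly) \<Rightarrow> ('n, 'k) mpoly \<Rightarrow> ('n, 'k) mpoly poly" where
  "flow_poly D P = Abs_poly (\<lambda>k. div_pow D k P)"

definition flow :: "(('n, 'k::field_char_0) mpoly \<Rightarrow> ('n, 'k) mpoly) \<Rightarrow> ('n, 'k) mpoly \<Rightarrow> ('n, 'k) mpoly \<Rightarrow> ('n, 'k) mpoly" where
  "flow D F P = poly (flow_poly D P) F"

lemma coeff_flow_poly: "lnd D \<Longrightarrow> coeff (flow_poly D P) k = div_pow D k P"
proof -
  assume D: "lnd D"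
  then obtain N where N: "(D ^^ N) P = 0" by (auto simp: lnd_def)
  have "\<forall>\<^sub>\<infinity>k. div_pow D k P = 0"
    unfolding MOST_nat_le
    using funpow_eq_0_mono[OF lnd_derivation[OF D] N] by (auto simp: div_pow_def intro!: exI[of _ N])
  then show ?thesis by (simp add: flow_poly_def Abs_poly_inverse)
qed

lemma flow_poly_add: "lnd D \<Longrightarrow> flow_poly D (P + Q) = flow_poly D P + flow_poly D Q"
  by (rule poly_eqI) (simp add: coeff_flow_poly div_pow_add lnd_derivation)

lemma flow_poly_mult: "lnd D \<Longrightarrow> flow_poly D (P * Q) = flow_poly D P * flow_poly D Q"
  by (rule poly_eqI) (simp add: coeff_flow_poly coeff_mult div_pow_mult lnd_derivation)

lemma flow_poly_Const: "lnd D \<Longrightarrow> flow_poly D (Const c) = [:Const c:]"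
  by (rule poly_eqI) (simp add: coeff_flow_poly div_pow_Const lnd_derivation coeff_pCons split: nat.split)

lemma flow_add: "lnd D \<Longrightarrow> flow D F (P + Q) = flow D F P + flow D F Q"
  by (simp add: flow_def flow_poly_add)

lemma flow_mult: "lnd D \<Longrightarrow> flow D F (P * Q) = flow D F P * flow D F Q"
  by (simp add: flow_def flow_poly_mult)

lemma flow_Const: "lnd D \<Longrightarrow> flow D F (Const c) = Const c"
  by (simp add: flow_def flow_poly_Const)

lemma flow_0 [simp]: "lnd D \<Longrightarrow> flow D 0 P = P"
  by (simp add: flow_def poly_0_coeff_0 coeff_flow_poly)

lemma flow_eq_sum:
  assumes "lnd D" "(D ^^ N) P = 0"
  shows "flow D F P = (\<Sum>k<N. div_pow D k P * F ^ k)"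
proof -
  have z: "div_pow D k P = 0" if "N \<le> k" for k
    using funpow_eq_0_mono[OF lnd_derivation[OF assms(1)] assms(2) that] by (simp add: div_pow_def)
  have "flow D F P = (\<Sum>k\<le>degree (flow_poly D P). div_pow D k P * F ^ k)"
    by (simp add: flow_def poly_altdef coeff_flow_poly[OF assms(1)])
  also have "\<dots> = (\<Sum>k\<in>{..degree (flow_poly D P)} \<union> {..<N}. div_pow D k P * F ^ k)"
    by (rule sum.mono_neutral_left)
       (auto simp: coeff_flow_poly[OF assms(1), symmetric] coeff_eq_0)
  also have "\<dots> = (\<Sum>k<N. div_pow D k P * F ^ k)"
    by (rule sum.mono_neutral_right) (auto simp: z)
  finally show ?thesis .
qed

lemma flow_ker: "lnd D \<Longrightarrow> D P = 0 \<Longrightarrow> flow D F P = P"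
  by (subst flow_eq_sum[where N = 1]) auto

lemma flow_ker2: "lnd D \<Longrightarrow> D (D P) = 0 \<Longrightarrow> flow D F P = P + D P * F"
  by (subst flow_eq_sum[where N = 2]) (auto simp: numeral_2_eq_2)

lemma flow_sum: "lnd D \<Longrightarrow> flow D F (\<Sum>x\<in>A. f x) = (\<Sum>x\<in>A. flow D F (f x))"
proof -
  assume D: "lnd D"
  have "flow D F 0 = 0" using flow_Const[OF D, of F 0] by simp
  then show ?thesis by (induction A rule: infinite_finite_induct) (simp_all add: flow_add[OF D])
qed

text \<open>Group law of the flow. The time \<open>F\<close> is fixed by the second flow, so the
  double sum can be collected along \<open>k + l = m\<close> into powers of \<open>F + G\<close> by
  the binomial theorem.\<close>

lemma flow_flow:
  assumes D: "lnd D" and F: "flow D G F = F"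
  shows "flow D G (flow D F P) = flow D (F + G) P"
proof -
  note der = lnd_derivation[OF D]
  obtain N where N: "(D ^^ N) P = 0" using D by (auto simp: lnd_def)
  have z: "div_pow D k P = 0" if "N \<le> k" for k
    using funpow_eq_0_mono[OF der N that] by (simp add: div_pow_def)
  have Fk: "flow D G (F ^ k) = F ^ k" for k
    using flow_Const[OF D, of G 1] by (induction k) (simp_all add: flow_mult[OF D] F)
  have "(D ^^ N) (div_pow D k P) = 0" for k
  proof -
    have "(D ^^ N) (div_pow D k P) = Const (inverse (fact k)) * (D ^^ (N + k)) P"
      by (simp add: div_pow_def funpow_derivation[OF der] funpow_add)
    then show ?thesis using funpow_eq_0_mono[OF der N, of "N + k"] by simp
  qed
  note e = flow_eq_sum[OF D this]
  let ?g = "\<lambda>k l. Const (of_nat ((k + l) choose k)) * div_pow D (k + l) P * G ^ l * F ^ k"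
  have "flow D G (flow D F P) = (\<Sum>k<N. \<Sum>l<N. ?g k l)"
    by (simp add: flow_eq_sum[OF D N] flow_sum[OF D] flow_mult[OF D] Fk e div_pow_div_pow[OF der] sum_distrib_right)
  also have "\<dots> = (\<Sum>(k, l)\<in>{..<N} \<times> {..<N}. ?g k l)"
    by (simp add: sum.cartesian_product)
  \<comment> \<open>Pairs with \<open>k + l \<ge> N\<close> contribute nothing, so the square of
    indices shrinks to a triangle.\<close>
  also have "\<dots> = (\<Sum>(k, l)\<in>{(k, l). k + l < N}. ?g k l)"
  proof (rule sum.mono_neutral_right, goal_cases)
    case 3
    show ?case
    proof
      fix x assume "x \<in> {..<N} \<times> {..<N} - {(k, l). k + l < N}"
      then obtain k l where "x = (k, l)" "N \<le> k + l" by (cases x) (auto simp: not_less)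
      then show "(case x of (k, l) \<Rightarrow> ?g k l) = 0" using z[of "k + l"] by simp
    qed
  qed auto
  also have "\<dots> = (\<Sum>m<N. \<Sum>k\<le>m. ?g k (m - k))"
    by (rule sum.triangle_reindex)
  also have "\<dots> = (\<Sum>m<N. div_pow D m P * (F + G) ^ m)"
    by (simp add: binomial_ring sum_distrib_left Const_of_nat mult_ac)
  also have "\<dots> = flow D (F + G) P"
    by (simp add: flow_eq_sum[OF D N])
  finally show ?thesis .
qed

text \<open>\<open>L\<close> is not assumed multiplicative, so the rule covers substitutions
  (\<open>flow_act\<close>) as well as derivations (\<open>flow_derivation\<close>).\<close>

lemma flow_intertwine:
  assumes D: "lnd D" "lnd D'"
    and add: "\<And>P Q. L (P + Q) = L P + L Q" and const: "\<And>c P. L (Const c * P) = Const c * L P"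
    and DL: "\<And>P. D (L P) = L (D' P)" and F: "\<And>P. L (F' * P) = F * L P"
  shows "flow D F (L P) = L (flow D' F' P)"
proof -
  have L0: "L 0 = 0" using const[of 0 0] by simp
  have Lsum: "L (\<Sum>x\<in>A. f x) = (\<Sum>x\<in>A. L (f x))" for A :: "nat set" and f
    by (induction A rule: infinite_finite_induct) (simp_all add: L0 add)
  have Lpow: "(D ^^ k) (L Q) = L ((D' ^^ k) Q)" for k Q
    by (induction k) (simp_all add: DL)
  have Fk: "L (Q * F' ^ k) = L Q * F ^ k" for Q k
  proof (induction k)
    case (Suc k)
    have "Q * F' ^ Suc k = F' * (Q * F' ^ k)"
      by (simp add: mult_ac)
    then have "L (Q * F' ^ Suc k) = F * L (Q * F' ^ k)"
      by (simp only: F)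
    then show ?case by (simp add: Suc mult_ac)
  qed simp
  obtain N where N: "(D' ^^ N) P = 0" using D by (auto simp: lnd_def)
  then have "(D ^^ N) (L P) = 0" by (simp add: Lpow L0)
  then show ?thesis
    by (simp add: flow_eq_sum[OF D(1)] flow_eq_sum[OF D(2) N] Lsum Fk div_pow_def const Lpow)
qed

lemma flow_act:
  assumes "lnd D" "lnd D'" "\<And>P. D (act P \<psi>) = act (D' P) \<psi>"
  shows "flow D (act F \<psi>) (act P \<psi>) = act (flow D' F P) \<psi>"
  by (rule flow_intertwine) (simp_all add: assms act_simps)

lemma flow_derivation:
  assumes "lnd D" "derivation E" "\<And>P. D (E P) = E (D P)" "E F = 0"
  shows "E (flow D F P) = flow D F (E P)"
  by (rule flow_intertwine[symmetric]) (simp_all add: assms derivationD[OF assms(2)])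

text \<open>A nonzero polynomial over an integral domain has finitely many roots, while
  characteristic zero supplies infinitely many constants.\<close>

lemma poly_eq_if_eq_on_Const:
  fixes p q :: "('n::linorder, 'k::field_char_0) mpoly poly"
  assumes "\<And>c. poly p (Const c) = poly q (Const c)"
  shows "p = q"
proof (rule ccontr)
  assume "p \<noteq> q"
  then have "finite {x. poly (p - q) x = 0}" by (intro poly_roots_finite) auto
  moreover have "range Const \<subseteq> {x. poly (p - q) x = 0}" using assms by auto
  moreover have "infinite (range (Const :: 'k \<Rightarrow> ('n, 'k) mpoly))"
    by (simp add: finite_image_iff inj_def infinite_UNIV_char_0)
  ultimately show False using finite_subset by blast
qed

text \<open>Recovers the derivation from its flow: both sides of \<open>eq\<close> are polynomials
  in \<open>c\<close>, and their linear coefficients are compared.\<close>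

lemma flow_intertwine_conv:
  fixes D D' :: "('n::linorder, 'k::field_char_0) mpoly \<Rightarrow> ('n, 'k) mpoly"
  assumes D: "lnd D" "lnd D'"
    and add: "\<And>P Q. L (P + Q) = L P + L Q" and const: "\<And>c P. L (Const c * P) = Const c * L P"
    and eq: "\<And>c. flow D (Const c * F) (L P) = L (flow D' (Const c * F') P)"
  shows "F * D (L P) = L (F' * D' P)"
proof -
  have L0: "L 0 = 0" using const[of 0 0] by simp
  have Lsum: "L (\<Sum>x\<in>A. f x) = (\<Sum>x\<in>A. L (f x))" for A :: "nat set" and f
    by (induction A rule: infinite_finite_induct) (simp_all add: L0 add)
  obtain M where M: "(D' ^^ M) P = 0" using D by (auto simp: lnd_def)
  obtain M' where M': "(D ^^ M') (L P) = 0" using D by (auto simp: lnd_def)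
  \<comment> \<open>At least 2, so that the linear term \<open>k = 1\<close> lies in the range
    \<open>k < N\<close>.\<close>
  define N where "N = Suc (Suc (max M M'))"
  have N: "(D' ^^ N) P = 0" "(D ^^ N) (L P) = 0"
    using funpow_eq_0_mono[OF lnd_derivation[OF D(2)] M, of N]
      funpow_eq_0_mono[OF lnd_derivation[OF D(1)] M', of N] by (auto simp: N_def)
  define p where "p = (\<Sum>k<N. monom (div_pow D k (L P) * F ^ k) k)"
  have 1: "(\<Sum>k<N. if k = Suc 0 then f k else 0) = f (Suc 0)" for f :: "nat \<Rightarrow> ('n, 'k) mpoly"
    by (simp add: N_def del: sum.lessThan_Suc)
  define q where "q = (\<Sum>k<N. monom (L (div_pow D' k P * F' ^ k)) k)"
  have "poly p (Const c) = poly q (Const c)" for c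
  proof -
    have "poly p (Const c) = flow D (Const c * F) (L P)"
      by (simp add: p_def poly_sum poly_monom flow_eq_sum[OF D(1) N(2)] power_mult_distrib mult_ac)
    moreover have "L (flow D' (Const c * F') P) = (\<Sum>k<N. L (Const (c ^ k) * (div_pow D' k P * F' ^ k)))"
      by (simp add: Lsum flow_eq_sum[OF D(2) N(1)] power_mult_distrib Const_power mult_ac)
    then have "L (flow D' (Const c * F') P) = poly q (Const c)"
      by (simp only: const) (simp add: q_def poly_sum poly_monom Const_power mult_ac)
    ultimately show ?thesis using eq by simp
  qed
  then have "coeff p 1 = coeff q 1" using poly_eq_if_eq_on_Const by metis
  then show ?thesis by (simp add: p_def q_def coeff_sum 1 mult.commute)
qed

text \<open>Since \<open>D F = 0\<close>, powers of \<open>F\<close> pull out and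
  \<open>(F D)^k = F^k D^k\<close>.\<close>

lemma flow_eq_exp_series:
  assumes D: "lnd D" and F: "D F = 0"
  shows "exp_series (\<lambda>P. F * D P) P = flow D F P"
proof -
  note der = lnd_derivation[OF D]
  have Fk: "D (F ^ k * Q) = F ^ k * D Q" for k Q
    using derivation_power_eq_0[OF der F] by (simp add: derivationD[OF der])
  have pow: "((\<lambda>P. F * D P) ^^ k) P = F ^ k * (D ^^ k) P" for k
    by (induction k) (simp_all add: Fk mult_ac)
  obtain N where N: "(D ^^ N) P = 0" using D by (auto simp: lnd_def)
  let ?g = "\<lambda>k. Const (inverse (fact k)) * ((\<lambda>P. F * D P) ^^ k) P"
  have g: "?g k = div_pow D k P * F ^ k" for k
    by (simp add: pow div_pow_def mult_ac)
  have "?g k = 0" if "N \<le> k" for k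
    using funpow_eq_0_mono[OF der N that] by (simp add: pow)
  then have "{k. ?g k \<noteq> 0} \<subseteq> {..<N}"
    using not_less by blast
  then have "exp_series (\<lambda>P. F * D P) P = (\<Sum>k<N. ?g k)"
    unfolding exp_series_def by (intro Sum_any.expand_superset) auto
  then show ?thesis by (simp add: g flow_eq_sum[OF D N])
qed

definition flow_map :: "(('n, 'k::field_char_0) mpoly \<Rightarrow> ('n, 'k) mpoly) \<Rightarrow> ('n, 'k) mpoly \<Rightarrow> ('n, 'k) pmap" where
  "flow_map D F = (\<lambda>i. flow D F (Var i))"

lemma act_flow_map: "lnd D \<Longrightarrow> act P (flow_map D F) = flow D F P"
  using act_unique[of "flow D F" P] by (simp add: flow_add flow_mult flow_Const flow_map_def)

subsection \<open>Directional derivatives\<close>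

definition dirderiv :: "('n::finite \<Rightarrow> 'k::comm_ring_1) \<Rightarrow> ('n, 'k) mpoly \<Rightarrow> ('n, 'k) mpoly" where
  "dirderiv u P = (\<Sum>j\<in>UNIV. Const (u j) * pderiv_var j P)"

lemma derivation_dirderiv: "derivation (dirderiv u)"
  by (simp add: derivation_def dirderiv_def derivationD[OF derivation_pderiv_var] sum.distrib
      distrib_left sum_distrib_left sum_distrib_right mult_ac)

lemma dirderiv_Var [simp]: "dirderiv u (Var i) = Const (u i)"
proof -
  have "dirderiv u (Var i) = (\<Sum>j\<in>UNIV. if j = i then Const (u j) else 0)"
    unfolding dirderiv_def by (intro sum.cong) (auto simp: pderiv_var_Var)
  then show ?thesis by simp
qed

lemma dirderiv_Const [simp]: "dirderiv u (Const c) = 0"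
  by (rule derivationD(4)[OF derivation_dirderiv])

lemma lnd_dirderiv: "lnd (dirderiv u)"
proof (rule lndI[OF derivation_dirderiv])
  fix i
  have "(dirderiv u ^^ 2) (Var i) = 0"
    by (simp add: numeral_2_eq_2)
  then show "\<exists>k. (dirderiv u ^^ k) (Var i) = 0" by blast
qed

lemma derivation_commute_if_Var:
  assumes "derivation D" "derivation E" "\<And>i. D (E (Var i)) = E (D (Var i))"
  shows "D (E P) = E (D P)"
  by (induction P rule: mpoly_induct)
    (simp_all add: derivationD[OF assms(1)] derivationD[OF assms(2)] assms(3) algebra_simps)

lemma dirderiv_commute: "dirderiv u (dirderiv v P) = dirderiv v (dirderiv u P)"
  by (rule derivation_commute_if_Var) (simp_all add: derivation_dirderiv)

lemma act_intertwine_if_Var: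
  assumes "derivation D" "derivation E" "\<And>i. D (\<psi> i) = act (E (Var i)) \<psi>"
  shows "D (act P \<psi>) = act (E P) \<psi>"
  by (induction P rule: mpoly_induct)
    (simp_all add: derivationD[OF assms(1)] derivationD[OF assms(2)] assms(3) act_simps)

lemma lookup_pderiv_var:
  fixes P :: "('n, 'k::comm_ring_1) mpoly"
  shows "Poly_Mapping.lookup (pderiv_var j P) m =
     of_nat (Suc (Poly_Mapping.lookup m j)) * Poly_Mapping.lookup P (m + Poly_Mapping.single j 1)"
proof -
  have s: "Poly_Mapping.lookup (pderiv_var j (Poly_Mapping.single m' c)) m =
     of_nat (Suc (Poly_Mapping.lookup m j)) * Poly_Mapping.lookup (Poly_Mapping.single m' c) (m + Poly_Mapping.single j 1)"
    for m' and c :: 'k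
  proof (cases "m' = m + Poly_Mapping.single j 1")
    case True
    then show ?thesis by (simp add: pderiv_var_single lookup_add lookup_single)
  next
    case False
    have "m' = m + Poly_Mapping.single j 1"
      if "m' - Poly_Mapping.single j 1 = m" "Poly_Mapping.lookup m' j \<noteq> 0"
      using single_diff_add[OF that(2), of "Poly_Mapping.single j 1"] that(1) by simp
    then show ?thesis using False
      by (cases "Poly_Mapping.lookup m' j = 0") (auto simp: pderiv_var_single lookup_single when_def)
  qed
  have "Poly_Mapping.lookup (pderiv_var j (\<Sum>x\<in>S. Poly_Mapping.single x (f x))) m =
     of_nat (Suc (Poly_Mapping.lookup m j)) * Poly_Mapping.lookup (\<Sum>x\<in>S. Poly_Mapping.single x (f x)) (m + Poly_Mapping.single j 1)"
    for S :: "('n \<Rightarrow>\<^sub>0 nat) set" and f :: "_ \<Rightarrow> 'k"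
    by (simp only: pderiv_var_sum lookup_sum sum_distrib_left s)
  from this[of "\<lambda>x. Poly_Mapping.lookup P x" "Poly_Mapping.keys P"] show ?thesis
    unfolding poly_mapping_sum_single .
qed

text \<open>In characteristic zero the coefficient at a monomial \<open>m \<noteq> 0\<close> can be
  read off from the partial derivative in a variable occurring in \<open>m\<close>.\<close>

lemma Const_if_pderiv_var_eq_0:
  fixes P :: "('n, 'k::field_char_0) mpoly"
  assumes "\<And>j. pderiv_var j P = 0"
  shows "\<exists>c. P = Const c"
proof -
  have "Poly_Mapping.lookup P m = 0" if m: "m \<noteq> 0" for m
  proof -
    obtain j where j: "Poly_Mapping.lookup m j \<noteq> 0"
      using m by (metis lookup_zero poly_mapping_eqI)
    have eq: "m - Poly_Mapping.single j 1 + Poly_Mapping.single j 1 = m"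
      using single_diff_add[OF j, of "Poly_Mapping.single j 1"] by simp
    show ?thesis
      using lookup_pderiv_var[of j P "m - Poly_Mapping.single j 1"] assms[of j]
      unfolding eq by (simp del: of_nat_Suc)
  qed
  then have "P = Const (Poly_Mapping.lookup P 0)"
    by (intro poly_mapping_eqI) (auto simp: Const_def lookup_single when_def)
  then show ?thesis by blast
qed

text \<open>The degree of \<^const>\<open>flow_poly\<close> is additive, and it is zero exactly on the kernel.\<close>
lemma lnd_factorially_closed:
  fixes P Q :: "('n::linorder, 'k::field_char_0) mpoly"
  assumes D: "lnd D" and "D (P * Q) = 0" "P * Q \<noteq> 0"
  shows "D P = 0"
proof -
  have "flow_poly D P * flow_poly D Q = [:P * Q:]"
  proof (rule poly_eqI)
    fix k
    show "coeff (flow_poly D P * flow_poly D Q) k = coeff [:P * Q:] k"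
      using assms(2) funpow_derivation(3)[OF lnd_derivation[OF D]]
      by (cases k) (simp_all add: flow_poly_mult[OF D, symmetric] coeff_flow_poly[OF D] div_pow_def funpow_swap1)
  qed
  moreover from this have "flow_poly D P \<noteq> 0" "flow_poly D Q \<noteq> 0" using assms(3) by auto
  ultimately have "degree (flow_poly D P) = 0"
    by (metis add_is_0 degree_mult_eq degree_pCons_0)
  then have "coeff (flow_poly D P) 1 = 0" by (simp add: coeff_eq_0)
  then show ?thesis by (simp add: coeff_flow_poly[OF D])
qed

lemma pderiv_var_eq_dirderiv: "pderiv_var j = dirderiv (\<lambda>i. if i = j then 1 else 0)"
proof
  fix P :: "('a, 'b) mpoly"
  have "dirderiv (\<lambda>i. if i = j then 1 else 0) P = (\<Sum>i\<in>UNIV. if i = j then pderiv_var i P else 0)"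
    unfolding dirderiv_def by (intro sum.cong) auto
  then show "pderiv_var j P = dirderiv (\<lambda>i. if i = j then 1 else 0) P" by simp
qed

lemma lnd_pderiv_var: "lnd (pderiv_var j :: ('n::finite, 'k::comm_ring_1) mpoly \<Rightarrow> _)"
  unfolding pderiv_var_eq_dirderiv by (rule lnd_dirderiv)

text \<open>The kernel of each partial derivative is factorially closed and contains the product,
  hence the factor \<open>P\<close>.\<close>

lemma Const_if_dvd_Const:
  fixes P Q :: "('n::{finite,linorder}, 'k::field_char_0) mpoly"
  assumes "P * Q = Const c" "c \<noteq> 0"
  shows "\<exists>a. P = Const a"
  by (rule Const_if_pderiv_var_eq_0, rule lnd_factorially_closed[OF lnd_pderiv_var, of _ P Q])
    (simp_all add: assms derivationD[OF derivation_pderiv_var])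

subsection \<open>The automorphism groups\<close>

lemma mult_GA [simp]: "mult GA \<phi> \<psi> = (\<lambda>i. act (\<phi> i) \<psi>)"
  by (simp add: GA_def units_of_def pmap_monoid_def)

lemma mult_SA [simp]: "mult SA \<phi> \<psi> = (\<lambda>i. act (\<phi> i) \<psi>)"
  by (simp add: SA_def)

lemma one_GA [simp]: "one GA = Var"
  by (simp add: GA_def units_of_def pmap_monoid_def)

lemma one_SA [simp]: "one SA = Var"
  by (simp add: SA_def)

lemma monoid_pmap: "monoid pmap_monoid"
  by unfold_locales (auto simp: pmap_monoid_def act_act)

lemma group_GA: "group GA"
  unfolding GA_def by (rule monoid.units_group[OF monoid_pmap])

lemma carrier_GA_iff:
  "\<phi> \<in> carrier GA \<longleftrightarrow> (\<exists>\<psi>. (\<lambda>i. act (\<phi> i) \<psi>) = Var \<and> (\<lambda>i. act (\<psi> i) \<phi>) = Var)"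
  by (auto simp: GA_def units_of_def Units_def pmap_monoid_def)

lemma det_hom:
  assumes "\<And>a b. h (a + b) = h a + h b" "\<And>a b. h (a * b) = h a * h b" "h 1 = 1"
  shows "h (det A) = det (\<chi> i j. h (A $ i $ j))"
proof -
  have h0: "h 0 = 0" using assms(1)[of 0 0] by simp
  have neg: "h (- a) = - h a" for a
    using assms(1)[of a "- a"] h0 by (simp add: eq_neg_iff_add_eq_0 add.commute)
  have sum: "h (\<Sum>x\<in>S. f x) = (\<Sum>x\<in>S. h (f x))" for S :: "('c \<Rightarrow> 'c) set" and f
    by (induction S rule: infinite_finite_induct) (simp_all add: h0 assms)
  have prod: "h (\<Prod>x\<in>S. f x) = (\<Prod>x\<in>S. h (f x))" for S :: "'c set" and f
    by (induction S rule: infinite_finite_induct) (simp_all add: assms)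
  have "h (of_int (sign p)) = of_int (sign p)" for p :: "'c \<Rightarrow> 'c"
    by (simp add: sign_def assms(3) neg)
  then show ?thesis by (simp add: det_def sum assms(2) prod)
qed

lemma jac_det_mult: "jac_det (\<lambda>i. act (\<phi> i) \<psi>) = act (jac_det \<phi>) \<psi> * jac_det \<psi>"
proof -
  have "(\<chi> i j. pderiv_var j (act (\<phi> i) \<psi>)) =
      (\<chi> i j. act (pderiv_var j (\<phi> i)) \<psi>) ** (\<chi> i j. pderiv_var j (\<psi> i))"
    by (simp add: vec_eq_iff matrix_matrix_mult_def derivation_act[OF derivation_pderiv_var])
  then show ?thesis
    by (simp add: jac_det_def det_mul det_hom[of "\<lambda>P. act P \<psi>"] act_simps)
qed

lemma jac_det_Var [simp]: "jac_det (Var :: ('n::finite, 'k::comm_ring_1) pmap) = 1"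
proof -
  have "(\<chi> i j. pderiv_var j (Var i)) = (mat 1 :: ('n, 'k) mpoly ^'n^'n)"
    by (simp add: vec_eq_iff mat_def pderiv_var_Var)
  then show ?thesis by (simp add: jac_det_def)
qed

lemma jac_det_GA:
  fixes \<phi> :: "('n::{finite,linorder}, 'k::field_char_0) pmap"
  assumes "\<phi> \<in> carrier GA" shows "\<exists>c. c \<noteq> 0 \<and> jac_det \<phi> = Const c"
proof -
  obtain \<psi> where "(\<lambda>i. act (\<psi> i) \<phi>) = Var" using assms by (auto simp: carrier_GA_iff)
  then have "act (jac_det \<psi>) \<phi> * jac_det \<phi> = 1" by (metis jac_det_mult jac_det_Var)
  then have "jac_det \<phi> * act (jac_det \<psi>) \<phi> = Const 1" by (simp add: mult.commute)
  from Const_if_dvd_Const[OF this] this show ?thesis by fastforce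
qed

lemma group_SA: "group (SA :: ('n::finite, 'k::comm_ring_1) pmap monoid)"
proof -
  interpret GA: group "GA :: ('n, 'k) pmap monoid" by (rule group_GA)
  have "subgroup {\<phi> \<in> carrier GA. jac_det \<phi> = 1} (GA :: ('n, 'k) pmap monoid)"
  proof (rule GA.subgroupI)
    show "{\<phi> \<in> carrier GA. jac_det \<phi> = 1} \<noteq> ({} :: ('n, 'k) pmap set)"
      using GA.one_closed by (auto intro!: exI[of _ Var])
    fix a b :: "('n, 'k) pmap"
    assume a: "a \<in> {\<phi> \<in> carrier GA. jac_det \<phi> = 1}"
    then have "(\<lambda>i. act (a i) (inv\<^bsub>GA\<^esub> a)) = Var"
      using GA.r_inv[of a] by simp
    then have "jac_det (inv\<^bsub>GA\<^esub> a) = 1"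
      using a jac_det_mult[of a "inv\<^bsub>GA\<^esub> a"] by simp
    then show "inv\<^bsub>GA\<^esub> a \<in> {\<phi> \<in> carrier GA. jac_det \<phi> = 1}" using a by simp
    assume b: "b \<in> {\<phi> \<in> carrier GA. jac_det \<phi> = 1}"
    then show "a \<otimes>\<^bsub>GA\<^esub> b \<in> {\<phi> \<in> carrier GA. jac_det \<phi> = 1}"
      using a GA.m_closed[of a b] by (simp add: jac_det_mult)
  qed auto
  then show ?thesis
    unfolding SA_def by (rule GA.subgroup_imp_group)
qed

lemma carrier_SA_iff: "\<phi> \<in> carrier SA \<longleftrightarrow> \<phi> \<in> carrier GA \<and> jac_det \<phi> = 1"
  by (simp add: SA_def)

lemma flow_map_mult:
  assumes "lnd D" "D F = 0"
  shows "(\<lambda>i. act (flow_map D F i) (flow_map D G)) = flow_map D (F + G)"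
  by (simp add: act_flow_map assms(1)) (simp add: flow_map_def flow_flow assms flow_ker)

lemma flow_map_0 [simp]: "lnd D \<Longrightarrow> flow_map D 0 = Var"
  by (simp add: flow_map_def)

lemma flow_map_GA: "lnd D \<Longrightarrow> D F = 0 \<Longrightarrow> flow_map D F \<in> carrier GA"
  by (auto simp: carrier_GA_iff flow_map_mult derivationD[OF lnd_derivation]
      intro!: exI[of _ "flow_map D (- F)"])

text \<open>The Jacobian determinant of \<open>exp (c F D)\<close> is a polynomial \<open>p\<close> in \<open>c\<close> with
  \<open>p(c) p(-c) = 1\<close>.\<close>
lemma jac_det_flow_map:
  fixes D :: "('n::{finite,linorder}, 'k::field_char_0) mpoly \<Rightarrow> ('n, 'k) mpoly"
  assumes D: "lnd D" and F: "D F = 0"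
  shows "jac_det (flow_map D F) = 1"
proof -
  note der = lnd_derivation[OF D]
  define J where "J c = jac_det (flow_map D (Const c * F))" for c
  have "\<forall>i. \<exists>N. (D ^^ N) (Var i) = 0"
    using D by (simp add: lnd_def)
  then obtain N where N: "(D ^^ N i) (Var i) = 0" for i
    by metis
  define p where "p = det (\<chi> i j. \<Sum>k<N i. monom (pderiv_var j (div_pow D k (Var i) * F ^ k)) k)"
  have Jp: "J c = poly p (Const c)" for c
  proof -
    have "poly p (Const c) = det (\<chi> i j. \<Sum>k<N i. pderiv_var j (div_pow D k (Var i) * F ^ k) * Const c ^ k)"
      by (simp add: p_def det_hom[of "\<lambda>q. poly q (Const c)"] poly_sum poly_monom)
    also have "(\<chi> i j. \<Sum>k<N i. pderiv_var j (div_pow D k (Var i) * F ^ k) * Const c ^ k) =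
       (\<chi> i j. pderiv_var j (flow_map D (Const c * F) i))"
      by (simp add: vec_eq_iff flow_map_def flow_eq_sum[OF D N] pderiv_var_sum power_mult_distrib
        Const_power[symmetric] derivationD(2)[OF derivation_pderiv_var] mult.left_commute mult.commute[of _ "Const _"])
    finally show ?thesis by (simp add: J_def jac_det_def)
  qed
  have "J c * J (- c) = 1" for c
  proof -
    have ker: "D (Const c * F) = 0" for c by (simp add: derivationD[OF der] F)
    \<comment> \<open>\<open>J c\<close> is constant, so the substitution in the chain rule leaves
      it unchanged.\<close>
    obtain a where "J c = Const a" using jac_det_GA[OF flow_map_GA[OF D ker]] unfolding J_def by blast
    then show ?thesis
      using jac_det_mult[of "flow_map D (Const c * F)" "flow_map D (Const (- c) * F)"]
      by (simp add: J_def flow_map_mult[OF D ker] Const_uminus D)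
  qed
  then have "poly (p * pcompose p [:0, -1:]) (Const c) = poly 1 (Const c)" for c
    by (simp add: Jp poly_pcompose Const_uminus)
  then have eq: "p * pcompose p [:0, -1:] = 1" by (rule poly_eq_if_eq_on_Const)
  \<comment> \<open>Degrees add over an integral domain, so \<open>p\<close> is constant and
    \<open>J 1\<close> equals \<open>J 0\<close>, which belongs to the identity.\<close>
  then have "p \<noteq> 0" "pcompose p [:0, -1:] \<noteq> 0" by auto
  then have "degree p = 0" using eq by (metis add_is_0 degree_1 degree_mult_eq)
  then obtain a where "p = [:a:]" by (metis degree_eq_zeroE)
  then have "J 1 = J 0" by (simp add: Jp)
  then show ?thesis by (simp add: J_def D)
qed

lemma flow_map_SA:
  fixes D :: "('n::{finite,linorder}, 'k::field_char_0) mpoly \<Rightarrow> ('n, 'k) mpoly"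
  shows "lnd D \<Longrightarrow> D F = 0 \<Longrightarrow> flow_map D F \<in> carrier SA"
  by (simp add: carrier_SA_iff flow_map_GA jac_det_flow_map)

section \<open>Linear and triangular automorphisms\<close>

lemma linear_pmap_mult: "(\<lambda>i. act (linear_pmap A i) (linear_pmap B)) = linear_pmap (A ** B)"
proof
  fix i
  have "act (linear_pmap A i) (linear_pmap B) = (\<Sum>j\<in>UNIV. \<Sum>k\<in>UNIV. Const (A $ i $ j * B $ j $ k) * Var k)"
    by (simp add: linear_pmap_def act_simps sum_distrib_left Const_mult mult.assoc)
  also have "\<dots> = (\<Sum>k\<in>UNIV. \<Sum>j\<in>UNIV. Const (A $ i $ j * B $ j $ k) * Var k)"
    by (rule sum.swap)
  also have "\<dots> = linear_pmap (A ** B) i"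
    by (simp add: linear_pmap_def matrix_matrix_mult_def sum_distrib_right[symmetric] Const_sum)
  finally show "act (linear_pmap A i) (linear_pmap B) = linear_pmap (A ** B) i" .
qed

lemma linear_pmap_1: "linear_pmap (mat 1) = Var"
proof
  fix i
  have "linear_pmap (mat 1) i = (\<Sum>j\<in>UNIV. if j = i then Var j else 0 :: ('a, 'b) mpoly)"
    unfolding linear_pmap_def by (intro sum.cong) (auto simp: mat_def)
  then show "linear_pmap (mat 1) i = (Var i :: ('a, 'b) mpoly)" by simp
qed

lemma linear_pmap_GA:
  fixes A :: "'k::field^'n^'n"
  assumes "det A \<noteq> 0" shows "linear_pmap A \<in> carrier GA"
proof -
  obtain B where "A ** B = mat 1" "B ** A = mat 1"
    using assms by (metis invertible_def invertible_det_nz)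
  then show ?thesis
    by (auto simp: carrier_GA_iff linear_pmap_mult linear_pmap_1 intro!: exI[of _ "linear_pmap B"])
qed

lemma dirderiv_linear_pmap:
  "dirderiv u (act P (linear_pmap A)) = act (dirderiv (\<lambda>i. \<Sum>j\<in>UNIV. A $ i $ j * u j) P) (linear_pmap A)"
proof (rule act_intertwine_if_Var[OF derivation_dirderiv derivation_dirderiv])
  fix i
  show "dirderiv u (linear_pmap A i) = act (dirderiv (\<lambda>i. \<Sum>j\<in>UNIV. A $ i $ j * u j) (Var i)) (linear_pmap A)"
    by (simp add: linear_pmap_def derivation_sum[OF derivation_dirderiv] derivationD[OF derivation_dirderiv] Const_mult[symmetric] Const_sum[symmetric])
qed

lemma finite_less_induct [case_names less]:
  fixes a :: "'a::{finite,order}"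
  assumes "\<And>x. (\<And>y. y < x \<Longrightarrow> P y) \<Longrightarrow> P x"
  shows "P a"
proof (induction "card {..<a}" arbitrary: a rule: less_induct)
  case less
  show ?case
  proof (rule assms)
    fix y assume "y < a"
    then have "{..<y} \<subset> {..<a}" by auto
    then show "P y" by (intro less psubset_card_mono) auto
  qed
qed

lemma BA_left_inverse:
  fixes \<tau> :: "('n::{finite,linorder}, 'k::field) pmap"
  assumes "\<tau> \<in> BA"
  shows "\<exists>\<sigma> \<in> BA. (\<lambda>i. act (\<sigma> i) \<tau>) = Var"
proof -
  obtain a P where a: "a i \<noteq> 0" and P: "P i \<in> polys_in {..<i}" and \<tau>: "\<tau> i = Const (a i) * Var i + P i" for i
    using assms unfolding BA_def by simp metis
  have Var: "\<exists>Q \<in> polys_in {..<i}. act (Const (inverse (a i)) * (Var i - Q)) \<tau> = Var i" for i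
  proof (induction i rule: finite_less_induct)
    case (less i)
    \<comment> \<open>The lower variables are in the image of substitution by \<open>\<tau>\<close>
      by induction, hence so are all polynomials in them, in particular \<open>P i\<close>.\<close>
    have "\<exists>Q' \<in> polys_in {..<i}. act Q' \<tau> = Q" if "Q \<in> polys_in {..<i}" for Q
      using that
    proof (induction Q rule: polys_in_induct)
      case (Const c)
      show ?case by (rule bexI[of _ "Const c"]) auto
    next
      case (Var j)
      then obtain R where "R \<in> polys_in {..<j}" "act (Const (inverse (a j)) * (Var j - R)) \<tau> = Var j"
        using less by auto
      moreover have "polys_in {..<j} \<subseteq> polys_in {..<i}" using Var by (intro polys_in_mono) auto
      ultimately show ?case using Var
        by (intro bexI[of _ "Const (inverse (a j)) * (Var j - R)"]) (auto intro!: polys_in_intros)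
    next
      case (add p q)
      then show ?case by (metis act_add polys_in_add)
    next
      case (mult p q)
      then show ?case by (metis act_mult polys_in_mult)
    qed
    then obtain Q where "Q \<in> polys_in {..<i}" "act Q \<tau> = P i" using P by blast
    then show ?case
      by (intro bexI[of _ Q]) (simp_all add: act_simps \<tau>[of i] mult.assoc[symmetric] Const_mult[symmetric] a)
  qed
  then obtain Q where Q: "Q i \<in> polys_in {..<i}" "act (Const (inverse (a i)) * (Var i - Q i)) \<tau> = Var i" for i
    by metis
  let ?\<sigma> = "\<lambda>i. Const (inverse (a i)) * (Var i - Q i)"
  have "?\<sigma> i = Const (inverse (a i)) * Var i + - (Const (inverse (a i)) * Q i)" for i
    by (simp add: algebra_simps)
  then have "?\<sigma> \<in> BA" unfolding BA_def
    using a Q(1) by (auto intro!: exI[of _ "inverse (a _)"] exI[of _ "- (Const (inverse (a _)) * Q _)"] polys_in_intros)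
  then show ?thesis using Q(2) by (intro bexI[of _ ?\<sigma>]) auto
qed

text \<open>The left inverse \<open>\<sigma>\<close> is triangular too, so it has a left inverse
  itself, which must be \<open>\<tau>\<close>.\<close>

lemma BA_GA: 
  fixes \<tau> :: "('n::{finite,linorder}, 'k::field) pmap"
  assumes "\<tau> \<in> BA" shows "\<tau> \<in> carrier GA"
proof -
  obtain \<sigma> where \<sigma>: "\<sigma> \<in> BA" "(\<lambda>i. act (\<sigma> i) \<tau>) = Var" using BA_left_inverse[OF assms] by blast
  obtain \<rho> where \<rho>: "(\<lambda>i. act (\<rho> i) \<sigma>) = Var" using BA_left_inverse[OF \<sigma>(1)] by blast
  have "\<rho> = (\<lambda>i. act (\<rho> i) (\<lambda>i. act (\<sigma> i) \<tau>))" by (simp add: \<sigma>)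
  also have "\<dots> = (\<lambda>i. act (act (\<rho> i) \<sigma>) \<tau>)" by (simp add: act_act)
  also have "\<dots> = \<tau>" using \<rho> by (simp add: fun_eq_iff)
  finally have "\<rho> = \<tau>" .
  then show ?thesis using \<sigma> \<rho> by (auto simp: carrier_GA_iff)
qed

section \<open>Flows in \<open>SA\<close>, translations and shears\<close>

lemma inv_flow_map:
  fixes D :: "('n::{finite,linorder}, 'k::field_char_0) mpoly \<Rightarrow> ('n, 'k) mpoly"
  assumes "lnd D" "D F = 0"
  shows "inv\<^bsub>SA\<^esub> (flow_map D F) = flow_map D (- F)"
proof -
  interpret group "SA :: ('n, 'k) pmap monoid" by (rule group_SA)
  have "D (- F) = 0" using assms derivationD[OF lnd_derivation] by fastforce
  then show ?thesis
    using assms by (intro inv_equality) (simp_all add: flow_map_mult flow_map_SA)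
qed

lemma flow_map_intertwine:
  assumes "lnd D" "lnd D'" "\<And>P. D (act P \<psi>) = act (D' P) \<psi>"
  shows "(\<lambda>i. act (\<psi> i) (flow_map D (act F \<psi>))) = (\<lambda>i. act (flow_map D' F i) \<psi>)"
proof
  fix i
  show "act (\<psi> i) (flow_map D (act F \<psi>)) = act (flow_map D' F i) \<psi>"
    using flow_act[OF assms, of F "Var i"]
    unfolding act_flow_map[OF assms(1)] by (simp add: flow_map_def)
qed

text \<open>Written as a flow at time 1 so that the lemmas on flows apply;
  \<open>translation_eq\<close> is the explicit form.\<close>

definition translation :: "('n::finite \<Rightarrow> 'k::field_char_0) \<Rightarrow> ('n, 'k) pmap" where
  "translation u = flow_map (dirderiv u) 1"

lemma flow_dirderiv_Var: "flow (dirderiv u) h (Var i) = Var i + Const (u i) * h"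
  by (subst flow_ker2[OF lnd_dirderiv]) simp_all

lemma flow_map_dirderiv: "flow_map (dirderiv u) h = (\<lambda>i. Var i + Const (u i) * h)"
  by (simp add: flow_map_def flow_dirderiv_Var)

lemma translation_eq: "translation u = (\<lambda>i. Var i + Const (u i))"
  by (simp add: translation_def flow_map_dirderiv)

lemma act_translation: "act P (translation u) = flow (dirderiv u) 1 P"
  by (simp add: translation_def act_flow_map lnd_dirderiv)

lemma flow_dirderiv_Const: "flow_map (dirderiv u) (Const c) = translation (\<lambda>i. c * u i)"
  by (simp add: flow_map_dirderiv translation_eq Const_mult mult.commute)

lemma translation_SA: "translation u \<in> carrier (SA :: ('n::{finite,linorder}, 'k::field_char_0) pmap monoid)"
  unfolding translation_def
  by (intro flow_map_SA lnd_dirderiv) (simp add: derivationD[OF derivation_dirderiv])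

lemma inv_translation:
  "inv\<^bsub>SA\<^esub> (translation u :: ('n::{finite,linorder}, 'k::field_char_0) pmap) = translation (\<lambda>i. - u i)"
  unfolding translation_def
  by (subst inv_flow_map)
    (simp_all add: derivationD[OF derivation_dirderiv] lnd_dirderiv flow_map_dirderiv Const_uminus)

lemma translation_mult: "(\<lambda>i. act (translation u i) (translation v)) = translation (\<lambda>i. u i + v i)"
  by (simp add: translation_eq act_simps Const_add add_ac)

lemma dirderiv_flow_dirderiv:
  "dirderiv u c = 0 \<Longrightarrow> dirderiv u (flow (dirderiv w) c P) = flow (dirderiv w) c (dirderiv u P)"
  by (rule flow_derivation) (simp_all add: lnd_dirderiv derivation_dirderiv dirderiv_commute)

lemma jac_det_linear_pmap: "jac_det (linear_pmap A) = Const (det A)"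
proof -
  have "pderiv_var j (linear_pmap A i) = Const (A $ i $ j)" for i j
  proof -
    have "pderiv_var j (linear_pmap A i) = (\<Sum>l\<in>UNIV. if l = j then Const (A $ i $ l) else 0)"
      unfolding linear_pmap_def derivation_sum[OF derivation_pderiv_var]
      by (intro sum.cong) (auto simp: derivationD[OF derivation_pderiv_var] pderiv_var_Var)
    then show ?thesis by simp
  qed
  then show ?thesis by (simp add: jac_det_def det_hom[of Const] Const_add Const_mult)
qed

definition row_add :: "'n \<Rightarrow> 'n \<Rightarrow> 'k::field \<Rightarrow> 'k^'n^'n \<Rightarrow> 'k^'n^'n" where
  "row_add i l c A = (\<chi> k. if k = i then row i A + c *s row l A else row k A)"

lemma row_add_nth: "row_add i l c A $ k $ j = (if k = i then A $ i $ j + c * A $ l $ j else A $ k $ j)"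
  by (simp add: row_add_def row_def)

lemma det_of_row_add: "i \<noteq> l \<Longrightarrow> det (row_add i l c A) = det A"
  unfolding row_add_def by (rule det_row_operation)

subsection \<open>Normal subgroups containing the special linear group\<close>

locale normal_subgroup_SA =
  fixes N :: "('n::{finite,linorder}, 'k::field_char_0) pmap set"
  assumes normal_N: "N \<lhd> SA"
begin

sublocale SA: group "SA :: ('n, 'k) pmap monoid"
  by (rule group_SA)

sublocale N: normal N SA
  by (rule normal_N)

lemma N_SA: "x \<in> N \<Longrightarrow> x \<in> carrier SA"
  using N.subset by blast

text \<open>Here \<open>h = x g x^-1\<close>, so the element is the commutator of \<open>x\<close>
  and \<open>g\<close>, a product of \<open>x\<close> and a conjugate of its inverse.\<close>

lemma conj_quotient:
  assumes x: "x \<in> N" and g: "g \<in> carrier SA" and h: "h \<in> carrier SA" and eq: "x \<otimes>\<^bsub>SA\<^esub> g = h \<otimes>\<^bsub>SA\<^esub> x"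
  shows "h \<otimes>\<^bsub>SA\<^esub> inv\<^bsub>SA\<^esub> g \<in> N"
proof -
  note [simp del] = mult_SA one_SA
  have "x \<otimes>\<^bsub>SA\<^esub> (g \<otimes>\<^bsub>SA\<^esub> inv\<^bsub>SA\<^esub> x \<otimes>\<^bsub>SA\<^esub> inv\<^bsub>SA\<^esub> g) \<in> N"
    using x g N.inv_op_closed2 by (meson N.m_closed N.m_inv_closed)
  moreover have "x \<otimes>\<^bsub>SA\<^esub> (g \<otimes>\<^bsub>SA\<^esub> inv\<^bsub>SA\<^esub> x \<otimes>\<^bsub>SA\<^esub> inv\<^bsub>SA\<^esub> g) = (x \<otimes>\<^bsub>SA\<^esub> g) \<otimes>\<^bsub>SA\<^esub> inv\<^bsub>SA\<^esub> x \<otimes>\<^bsub>SA\<^esub> inv\<^bsub>SA\<^esub> g"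
    using g N_SA[OF x] by (simp add: SA.m_assoc)
  also have "\<dots> = h \<otimes>\<^bsub>SA\<^esub> inv\<^bsub>SA\<^esub> g"
    using g h N_SA[OF x] unfolding eq by (simp add: SA.m_assoc)
  finally show ?thesis by simp
qed

lemma conj_cancel:
  assumes x: "x \<in> N" and g: "g \<in> carrier SA" and h: "h \<in> carrier SA" and eq: "g \<otimes>\<^bsub>SA\<^esub> h = x \<otimes>\<^bsub>SA\<^esub> g"
  shows "h \<in> N"
proof -
  note [simp del] = mult_SA one_SA
  have "inv\<^bsub>SA\<^esub> g \<otimes>\<^bsub>SA\<^esub> x \<otimes>\<^bsub>SA\<^esub> g \<in> N" using x g by (rule N.inv_op_closed1[rotated])
  also have "inv\<^bsub>SA\<^esub> g \<otimes>\<^bsub>SA\<^esub> x \<otimes>\<^bsub>SA\<^esub> g = inv\<^bsub>SA\<^esub> g \<otimes>\<^bsub>SA\<^esub> (g \<otimes>\<^bsub>SA\<^esub> h)"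
    unfolding eq using N_SA[OF x] g by (simp add: SA.m_assoc)
  also have "\<dots> = h" using g h by (simp add: SA.m_assoc[symmetric])
  finally show ?thesis .
qed

lemma mult_cancel:
  assumes x: "x \<in> N" and g: "g \<in> carrier SA" and xg: "x \<otimes>\<^bsub>SA\<^esub> g \<in> N"
  shows "g \<in> N"
proof -
  note [simp del] = mult_SA one_SA
  have "inv\<^bsub>SA\<^esub> x \<otimes>\<^bsub>SA\<^esub> (x \<otimes>\<^bsub>SA\<^esub> g) \<in> N"
    by (rule N.m_closed[OF N.m_inv_closed[OF x] xg])
  also have "inv\<^bsub>SA\<^esub> x \<otimes>\<^bsub>SA\<^esub> (x \<otimes>\<^bsub>SA\<^esub> g) = g"
    using g N_SA[OF x] by (simp add: SA.m_assoc[symmetric])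
  finally show ?thesis .
qed

text \<open>The commutator of \<open>x\<close> with the flow at time \<open>- g\<close> is again a
  flow of \<open>D\<close>, because \<open>x\<close> maps the kernel of \<open>D\<close> into
  itself.\<close>

lemma flow_quotient:
  assumes x: "x \<in> N" and D: "lnd D" and comm: "\<And>P. D (act P x) = act (D P) x" and g: "D g = 0"
  shows "flow_map D (act g x - g) \<in> N"
proof -
  note der = derivationD[OF lnd_derivation[OF D]]
  have ker: "D (act g x) = 0" "D (- g) = 0" "D (act (- g) x) = 0" by (simp_all add: comm g der act_simps)
  have "flow_map D (- g) \<otimes>\<^bsub>SA\<^esub> inv\<^bsub>SA\<^esub> (flow_map D (act (- g) x)) \<in> N"
    using flow_map_intertwine[OF D D comm, of "- g"]
    by (intro conj_quotient[OF x] flow_map_SA D ker) simp_all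
  then have "flow_map D (- g + - act (- g) x) \<in> N"
    by (simp only: inv_flow_map[OF D ker(3)] mult_SA flow_map_mult[OF D ker(2)])
  then show ?thesis by (simp add: act_uminus)
qed

text \<open>Conjugation by the translation along \<open>w\<close> shifts \<open>h\<close>; dividing
  by the original shear leaves the finite difference of \<open>h\<close>.\<close>

lemma shear_translate:
  assumes h: "flow_map (dirderiv u) h \<in> N" "dirderiv u h = 0"
  shows "flow_map (dirderiv u) (flow (dirderiv w) 1 h - h) \<in> N"
proof -
  note [simp] = lnd_dirderiv
  let ?T = "translation w"
  have "dirderiv u (1 :: ('n, 'k) mpoly) = 0" by (simp add: derivationD[OF derivation_dirderiv])
  note df = dirderiv_flow_dirderiv[OF this]
  have eq: "?T \<otimes>\<^bsub>SA\<^esub> flow_map (dirderiv u) (flow (dirderiv w) 1 h) = flow_map (dirderiv u) h \<otimes>\<^bsub>SA\<^esub> ?T"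
    using flow_map_intertwine[of "dirderiv u" "dirderiv u" ?T h] by (simp add: act_translation df)
  have ker: "dirderiv u (flow (dirderiv w) 1 h) = 0"
    using flow_Const[OF lnd_dirderiv, of w 1 0] by (simp add: df h)
  then have SA: "flow_map (dirderiv u) (flow (dirderiv w) 1 h) \<in> carrier SA"
    by (simp add: flow_map_SA)
  have "flow_map (dirderiv u) (flow (dirderiv w) 1 h) \<in> N"
    using conj_cancel[OF h(1) translation_SA SA] eq by simp
  then have "flow_map (dirderiv u) (flow (dirderiv w) 1 h) \<otimes>\<^bsub>SA\<^esub> inv\<^bsub>SA\<^esub> flow_map (dirderiv u) h \<in> N"
    using h(1) by (intro N.m_closed N.m_inv_closed)
  then show ?thesis
    by (simp add: inv_flow_map h flow_map_mult ker)
qed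

text \<open>Commutators of \<open>x\<close> with shears along \<open>u\<close> are shears along \<open>u\<close>; if all of them are trivial,
  then \<open>x\<close> fixes the kernel of \<^term>\<open>dirderiv u\<close> and is itself a shear.\<close>
lemma commuting_imp_shear:
  assumes x: "x \<in> N" "x \<noteq> Var" and u: "u j \<noteq> 0"
    and comm: "\<And>P. dirderiv u (act P x) = act (dirderiv u P) x"
  shows "\<exists>h. h \<noteq> 0 \<and> dirderiv u h = 0 \<and> flow_map (dirderiv u) h \<in> N"
proof (cases "\<exists>g. dirderiv u g = 0 \<and> act g x \<noteq> g")
  case True
  then obtain g where g: "dirderiv u g = 0" "act g x \<noteq> g" by blast
  then show ?thesis
    using flow_quotient[OF x(1) lnd_dirderiv comm g(1)]
    by (intro exI[of _ "act g x - g"]) (simp add: derivationD[OF derivation_dirderiv] comm)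
next
  case False
  define h where "h = Const (inverse (u j)) * (x j - Var j)"
  have fixed: "act g x = g" if "dirderiv u g = 0" for g using False that by blast
  have xi: "x i = Var i + Const (u i) * h" for i
  proof -
    \<comment> \<open>These linear forms lie in the kernel and are therefore fixed, so
      \<open>x\<close> moves points along \<open>u\<close> only.\<close>
    have "dirderiv u (Const (u j) * Var i - Const (u i) * Var j) = 0"
      by (simp add: derivationD[OF derivation_dirderiv] mult.commute)
    from fixed[OF this] have "Const (u j) * (x i - Var i) = Const (u i) * (x j - Var j)"
      by (simp add: act_simps algebra_simps)
    then have "Const (inverse (u j)) * (Const (u j) * (x i - Var i)) = Const (u i) * h"
      by (simp add: h_def mult_ac)
    moreover have "Const (inverse (u j)) * (Const (u j) * (x i - Var i)) = x i - Var i"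
      using u by (simp add: mult.assoc[symmetric] Const_mult[symmetric])
    ultimately show ?thesis by (simp add: algebra_simps)
  qed
  have "dirderiv u (x j) = Const (u j)" using comm[of "Var j"] by simp
  then have "dirderiv u h = 0"
    by (simp add: h_def derivationD[OF derivation_dirderiv])
  moreover have "x = flow_map (dirderiv u) h"
    by (rule ext) (simp add: flow_map_dirderiv xi)
  moreover have "h \<noteq> 0"
  proof
    assume "h = 0"
    then have "x = Var" by (intro ext) (simp add: xi)
    then show False using x(2) by simp
  qed
  ultimately show ?thesis using x(1) by auto
qed

text \<open>Finite differences of \<open>h\<close> in one variable after another lower its degree
  until a nonzero constant is left; a shear with constant \<open>h\<close> is a translation.\<close>

lemma shear_imp_translation:
  assumes "h \<noteq> 0" "dirderiv u h = 0" "flow_map (dirderiv u) h \<in> N"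
  shows "\<exists>c. c \<noteq> 0 \<and> translation (\<lambda>i. c * u i) \<in> N"
proof -
  \<comment> \<open>Induction over the set \<open>S\<close> of variables that no longer occur in
    \<open>h\<close>.\<close>
  have "\<exists>h. h \<noteq> 0 \<and> dirderiv u h = 0 \<and> flow_map (dirderiv u) h \<in> N \<and> (\<forall>j\<in>S. pderiv_var j h = 0)"
    if "finite S" for S
    using that
  proof (induction S rule: finite_induct)
    case empty
    show ?case using assms by auto
  next
    case (insert j S)
    define W :: "('n, 'k) mpoly \<Rightarrow> ('n, 'k) mpoly" where "W = pderiv_var j"
    have W: "lnd W" unfolding W_def by (rule lnd_pderiv_var)
    have W1: "W 1 = 0" by (rule derivationD(6)[OF lnd_derivation[OF W]])
    note Wflow = flow_derivation[OF W lnd_derivation[OF W] refl W1]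
    have Wpow: "(W ^^ r) (flow W 1 P) = flow W 1 ((W ^^ r) P)" for r P
      by (induction r) (simp_all add: Wflow)
    note Wdiff = derivationD(8)[OF lnd_derivation[OF W]]
    have Wpow_diff: "(W ^^ r) (P - Q) = (W ^^ r) P - (W ^^ r) Q" for r P Q
      by (induction r) (simp_all add: Wdiff)
    \<comment> \<open>\<open>m\<close> is the degree of \<open>h\<close> in the variable
      \<open>j\<close>. A unit difference lowers it by exactly one, since the new top derivative
      equals the old one.\<close>
    have descent: "\<exists>h. h \<noteq> 0 \<and> dirderiv u h = 0 \<and> flow_map (dirderiv u) h \<in> N \<and> (\<forall>j\<in>S. pderiv_var j h = 0) \<and> W h = 0"
      if "(W ^^ Suc m) h = 0" "(W ^^ m) h \<noteq> 0" "dirderiv u h = 0" "flow_map (dirderiv u) h \<in> N" "\<forall>j\<in>S. pderiv_var j h = 0"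
      for m h
      using that
    proof (induction m arbitrary: h)
      case 0
      then show ?case by auto
    next
      case (Suc m)
      have "(W ^^ m) (flow W 1 h - h) = (W ^^ Suc m) h"
        using Suc.prems(1) by (simp add: Wpow_diff Wpow flow_ker2[OF W])
      then have 1: "(W ^^ m) (flow W 1 h - h) \<noteq> 0" using Suc.prems(2) by simp
      have "(W ^^ Suc m) (flow W 1 h - h) = 0"
        using flow_ker[OF W, of "(W ^^ Suc m) h" 1] Suc.prems(1) by (simp only: Wpow_diff Wpow) simp
      \<comment> \<open>Differences commute with directional derivatives, so the properties already
        gained persist.\<close>
      moreover have pd: "dirderiv v (flow W 1 h - h) = 0" if "dirderiv v h = 0" for v
      proof -
        have "dirderiv v (1 :: ('n, 'k) mpoly) = 0" by (simp add: derivationD[OF derivation_dirderiv])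
        then show ?thesis
          using that flow_Const[OF lnd_dirderiv, of _ _ 0]
          unfolding W_def pderiv_var_eq_dirderiv
          by (simp add: derivationD[OF derivation_dirderiv] dirderiv_flow_dirderiv)
      qed
      moreover have "flow_map (dirderiv u) (flow W 1 h - h) \<in> N"
        using shear_translate[OF Suc.prems(4,3)] unfolding W_def pderiv_var_eq_dirderiv .
      moreover have "\<forall>l\<in>S. pderiv_var l (flow W 1 h - h) = 0"
        using Suc.prems(5) pd unfolding pderiv_var_eq_dirderiv by blast
      ultimately show ?case by (intro Suc.IH[OF _ 1]) (use pd[OF Suc.prems(3)] in blast)+
    qed
    obtain h where h: "h \<noteq> 0" "dirderiv u h = 0" "flow_map (dirderiv u) h \<in> N" "\<forall>j\<in>S. pderiv_var j h = 0"
      using insert.IH by blast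
    obtain m where m: "(W ^^ Suc m) h = 0" "(W ^^ m) h \<noteq> 0"
    proof -
      obtain k where "(W ^^ k) h = 0" using W unfolding lnd_def by blast
      then have "(W ^^ (LEAST k. (W ^^ k) h = 0)) h = 0" by (rule LeastI)
      moreover have "(LEAST k. (W ^^ k) h = 0) \<noteq> 0" using calculation h(1) by (metis funpow_0)
      moreover have "(W ^^ k) h \<noteq> 0" if "k < (LEAST k. (W ^^ k) h = 0)" for k
        using not_less_Least that by blast
      ultimately show ?thesis using that by (metis lessI not0_implies_Suc)
    qed
    obtain h where "h \<noteq> 0" "dirderiv u h = 0" "flow_map (dirderiv u) h \<in> N" "\<forall>j\<in>S. pderiv_var j h = 0" "W h = 0"
      using descent[OF m h(2-4)] by blast
    then show ?case unfolding W_def by blast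
  qed
  from this[of UNIV] obtain h where h: "h \<noteq> 0" "flow_map (dirderiv u) h \<in> N" "\<And>j. pderiv_var j h = 0"
    by auto
  obtain c where "h = Const c" using Const_if_pderiv_var_eq_0[OF h(3)] by blast
  then show ?thesis using h by (auto simp: flow_dirderiv_Const intro!: exI[of _ c])
qed

lemma translation_imp_shear:
  assumes u: "translation u \<in> N" and g: "dirderiv w g = 0"
  shows "flow_map (dirderiv w) (flow (dirderiv u) 1 g - g) \<in> N"
proof -
  have "dirderiv w (1 :: ('n, 'k) mpoly) = 0" by (simp add: derivationD[OF derivation_dirderiv])
  from dirderiv_flow_dirderiv[OF this] show ?thesis
    using flow_quotient[OF u lnd_dirderiv, of w g] by (simp add: act_translation g)
qed

lemma translation_imp_axis:
  assumes u: "translation u \<in> N" "u j \<noteq> 0" and "i \<noteq> j"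
  shows "flow_map (pderiv_var i) (Const c) \<in> N"
proof -
  \<comment> \<open>The linear form \<open>(c / u j) x_j\<close> grows by exactly \<open>c\<close>
    under the translation, and the derivative along axis \<open>i\<close> kills it.\<close>
  have "flow_map (pderiv_var i) (flow (dirderiv u) 1 (Const (c / u j) * Var j) - Const (c / u j) * Var j) \<in> N"
    unfolding pderiv_var_eq_dirderiv
    by (rule translation_imp_shear[OF u(1)]) (use assms in \<open>simp add: derivationD[OF derivation_dirderiv]\<close>)
  moreover have "flow (dirderiv u) 1 (Const (c / u j) * Var j) - Const (c / u j) * Var j = Const c"
    using u(2) by (simp add: flow_mult flow_Const lnd_dirderiv flow_dirderiv_Var distrib_left Const_mult[symmetric])
  ultimately show ?thesis by simp
qed

text \<open>Commutators of the translation with shears give all axis translations and then the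
  transvections; Gaussian elimination reduces every matrix of determinant 1 to the identity by
  these.\<close>

lemma translation_imp_SL_subset:
  fixes u :: "'n \<Rightarrow> 'k"
  assumes card: "2 \<le> card (UNIV :: 'n set)" and u: "translation u \<in> N" "u j \<noteq> 0"
  shows "SL \<subseteq> N"
proof -
  have "UNIV \<noteq> {j}"
  proof
    assume "UNIV = {j}"
    then have "card (UNIV :: 'n set) = card {j}" by (rule arg_cong)
    then show False using card by simp
  qed
  then obtain i0 where "i0 \<noteq> j" by blast
  have axis: "flow_map (pderiv_var i) (Const c) \<in> N" for i c
  proof (cases "i = j")
    case True
    \<comment> \<open>The axis \<open>j\<close> itself is reached through a translation along
      another axis \<open>i0\<close>.\<close>
    have "translation (\<lambda>i. if i = i0 then 1 else 0) \<in> N"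
      using translation_imp_axis[OF u \<open>i0 \<noteq> j\<close>, of 1]
      unfolding pderiv_var_eq_dirderiv flow_dirderiv_Const by simp
    then show ?thesis using translation_imp_axis[of _ i0 i c] True \<open>i0 \<noteq> j\<close> by simp
  qed (use translation_imp_axis[OF u] in blast)
  have transvection: "flow_map (pderiv_var i) (Const c * Var l) \<in> N" if "i \<noteq> l" for i l c
  proof -
    let ?e = "\<lambda>i. if i = l then 1 else (0::'k)"
    \<comment> \<open>The unit difference of this square along \<open>l\<close> is
      \<open>c x_l + c/2\<close>; the constant is then removed by an axis translation.\<close>
    let ?g = "Const (c / 2) * (Var l * Var l)"
    have "translation ?e \<in> N"
      using axis[of l 1] unfolding pderiv_var_eq_dirderiv flow_dirderiv_Const by simp
    moreover have "pderiv_var i ?g = 0"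
      using that by (simp add: derivationD[OF derivation_pderiv_var] pderiv_var_Var)
    ultimately have "flow_map (pderiv_var i) (flow (dirderiv ?e) 1 ?g - ?g) \<in> N"
      using translation_imp_shear[of ?e] unfolding pderiv_var_eq_dirderiv by blast
    moreover have "flow (dirderiv ?e) 1 ?g - ?g = Const c * Var l + Const (c / 2)"
    proof -
      have "Const c = Const (c / 2) + (Const (c / 2) :: ('n, 'k) mpoly)"
        by (simp add: Const_add[symmetric])
      then show ?thesis
        by (simp add: flow_mult flow_Const lnd_dirderiv flow_dirderiv_Var algebra_simps)
    qed
    ultimately have "flow_map (pderiv_var i) (Const c * Var l + Const (c / 2)) \<in> N" by simp
    then have "flow_map (pderiv_var i) (Const c * Var l + Const (c / 2)) \<otimes>\<^bsub>SA\<^esub> flow_map (pderiv_var i) (Const (- (c / 2))) \<in> N"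
      using axis by (intro N.m_closed)
    then show ?thesis
      using that by (simp add: flow_map_mult lnd_pderiv_var derivationD[OF derivation_pderiv_var] pderiv_var_Var Const_uminus)
  qed
  \<comment> \<open>A row operation is left multiplication by a transvection, so membership in
    \<open>N\<close> can be pulled back along it.\<close>
  have good_row_add: "linear_pmap A \<in> N"
    if "linear_pmap (row_add i l c A) \<in> N" "det A = 1" "i \<noteq> l" for A i l c
  proof -
    note [simp del] = mult_SA one_SA
    have A: "linear_pmap A \<in> carrier SA"
      using linear_pmap_GA[of A] that(2) by (simp add: carrier_SA_iff jac_det_linear_pmap)
    have "(\<lambda>k. act (flow_map (pderiv_var i) (Const c * Var l) k) (linear_pmap A)) = linear_pmap (row_add i l c A)"
    proof
      fix k
      show "act (flow_map (pderiv_var i) (Const c * Var l) k) (linear_pmap A) = linear_pmap (row_add i l c A) k"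
        unfolding pderiv_var_eq_dirderiv
        by (simp add: flow_map_dirderiv act_simps linear_pmap_def row_add_nth Const_add Const_mult
            sum.distrib sum_distrib_left distrib_right mult.assoc)
    qed
    then have "flow_map (pderiv_var i) (Const c * Var l) \<otimes>\<^bsub>SA\<^esub> linear_pmap A \<in> N"
      using that(1) by (simp add: mult_SA)
    then show ?thesis
      using mult_cancel[OF transvection[OF that(3)] A] by blast
  qed
  \<comment> \<open>The columns in \<open>S\<close> agree with those of the identity. A row outside
    \<open>S\<close> has zeros there, so adding it to another row preserves this.\<close>
  define std where "std S A \<longleftrightarrow> (\<forall>j\<in>S. \<forall>i. A $ i $ j = (if i = j then 1 else 0))" for S and A :: "(('k, 'n) vec, 'n) vec"
  have std_row_add: "std S (row_add i l c A)" if "std S A" "l \<notin> S" for S i l c A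
    using that unfolding std_def row_add_nth by auto
  \<comment> \<open>Clears column \<open>j\<close> with a nonzero pivot \<open>p\<close>, by
    induction on the number of nonzero entries off the diagonal; the first premise treats the
    cleared matrix.\<close>
  have elim: "linear_pmap A \<in> N"
    if "\<And>B. det B = 1 \<Longrightarrow> std S B \<Longrightarrow> B $ j $ j = p \<Longrightarrow> (\<forall>i. i \<noteq> j \<longrightarrow> B $ i $ j = 0) \<Longrightarrow> linear_pmap B \<in> N"
      and "det A = 1" "std S A" "A $ j $ j = p" "p \<noteq> 0" "j \<notin> S" for S A j p
    using that(2-)
  proof (induction "card {i. i \<noteq> j \<and> A $ i $ j \<noteq> 0}" arbitrary: A rule: less_induct)
    case less
    show ?case
    proof (cases "\<forall>i. i \<noteq> j \<longrightarrow> A $ i $ j = 0")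
      case True
      then show ?thesis using that(1) less.prems by blast
    next
      case False
      then obtain i where i: "i \<noteq> j" "A $ i $ j \<noteq> 0" by blast
      let ?B = "row_add i j (- (A $ i $ j / p)) A"
      have "{k. k \<noteq> j \<and> ?B $ k $ j \<noteq> 0} \<subset> {k. k \<noteq> j \<and> A $ k $ j \<noteq> 0}"
        using i less.prems by (auto simp: row_add_nth split: if_splits)
      then have "card {k. k \<noteq> j \<and> ?B $ k $ j \<noteq> 0} < card {k. k \<noteq> j \<and> A $ k $ j \<noteq> 0}"
        by (intro psubset_card_mono) auto
      then have "linear_pmap ?B \<in> N"
        by (rule less.hyps) (use less.prems i in \<open>auto simp: det_of_row_add std_row_add row_add_nth\<close>)
      then show ?thesis using good_row_add less.prems i by blast
    qed
  qed
  \<comment> \<open>Induction on the number of columns that are not yet standard.\<close>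
  have "linear_pmap A \<in> N" if "det A = 1" "std S A" for A S
    using that
  proof (induction "card (UNIV - S)" arbitrary: A S rule: less_induct)
    case less
    show ?case
    proof (cases "S = UNIV")
      case True
      then have "A = mat 1" using less.prems(2) by (auto simp: std_def vec_eq_iff mat_def)
      then show ?thesis using N.one_closed by (simp add: linear_pmap_1)
    next
      case False
      then obtain j where j: "j \<notin> S" by blast
      have smaller: "card (UNIV - insert j S) < card (UNIV - S)"
        using j by (intro psubset_card_mono) auto
      have one: "linear_pmap B \<in> N" if "det B = 1" "std S B" "B $ j $ j = 1" for B
      proof (rule elim[OF _ that _ j])
        fix C :: "(('k, 'n) vec, 'n) vec"
        assume "det C = 1" "std S C" "C $ j $ j = 1" "\<forall>i. i \<noteq> j \<longrightarrow> C $ i $ j = 0"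
        then show "linear_pmap C \<in> N"
          by (intro less.hyps[OF smaller]) (auto simp: std_def)
      qed simp
      \<comment> \<open>A nonzero entry in another row outside \<open>S\<close> turns the pivot into
        1 with one row operation.\<close>
      have off: "linear_pmap B \<in> N" if "det B = 1" "std S B" "B $ l $ j \<noteq> 0" "l \<notin> S" "l \<noteq> j" for B l
      proof -
        let ?C = "row_add j l ((1 - B $ j $ j) / B $ l $ j) B"
        have "linear_pmap ?C \<in> N"
          using that by (intro one) (auto simp: det_of_row_add std_row_add row_add_nth)
        then show ?thesis using good_row_add that by blast
      qed
      show ?thesis
      proof (cases "\<exists>l. l \<notin> S \<and> l \<noteq> j \<and> A $ l $ j \<noteq> 0")
        case True
        then show ?thesis using off less.prems by blast
      next
        case no_off: False
        have Ajj: "A $ j $ j \<noteq> 0"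
        proof
          assume 0: "A $ j $ j = 0"
          \<comment> \<open>If the pivot vanished as well, column \<open>j\<close> would be
            supported on \<open>S\<close> and hence be a combination of the unit columns there;
            \<open>x\<close> records this dependency.\<close>
          define x :: "('k, 'n) vec" where "x = (\<chi> l. if l = j then 1 else if l \<in> S then - A $ l $ j else 0)"
          have "A *v x = 0"
          proof -
            have "(\<Sum>l\<in>UNIV. A $ i $ l * x $ l) = 0" for i
            proof -
              have "(\<Sum>l\<in>UNIV. A $ i $ l * x $ l) = (\<Sum>l\<in>UNIV. (if l = j then A $ i $ j else 0) + (if l = i then if l \<in> S then - A $ l $ j else 0 else 0))"
                using j less.prems(2) by (intro sum.cong) (auto simp: x_def std_def)
              also have "\<dots> = A $ i $ j + (if i \<in> S then - A $ i $ j else 0)"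
                by (simp add: sum.distrib)
              also have "\<dots> = 0" using 0 no_off by (auto split: if_splits)
              finally show ?thesis .
            qed
            then show ?thesis by (simp add: vec_eq_iff matrix_vector_mult_def)
          qed
          moreover obtain B where "B ** A = mat 1"
            using less.prems(1) by (metis invertible_def invertible_det_nz one_neq_zero)
          ultimately have "x = 0"
            by (metis matrix_vector_mul_assoc matrix_vector_mul_lid matrix_vector_mult_0_right)
          then have "x $ j = 0" by simp
          then show False by (simp add: x_def)
        qed
        show ?thesis
        proof (cases "\<exists>l. l \<notin> S \<and> l \<noteq> j")
          case True
          then obtain l where l: "l \<notin> S" "l \<noteq> j" by blast
          \<comment> \<open>Adding the pivot row to row \<open>l\<close> creates the entry that
            \<open>off\<close> asks for.\<close>
          have "linear_pmap (row_add l j 1 A) \<in> N"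
            using less.prems l j Ajj no_off
            by (intro off[of _ l]) (auto simp: det_of_row_add std_row_add row_add_nth)
          then show ?thesis using good_row_add l less.prems by blast
        next
          case S: False
          \<comment> \<open>Only column \<open>j\<close> is left: clearing it makes the matrix
            diagonal, and the determinant forces the pivot to be 1.\<close>
          show ?thesis
          proof (rule elim[OF _ less.prems refl Ajj j])
            fix B :: "(('k, 'n) vec, 'n) vec"
            assume B: "det B = 1" "std S B" "B $ j $ j = A $ j $ j" "\<forall>i. i \<noteq> j \<longrightarrow> B $ i $ j = 0"
            have entries: "B $ i $ l = (if i = l then if l = j then B $ j $ j else 1 else 0)" for i l
            proof (cases "l = j")
              case False
              then have "l \<in> S" using S by blast
              then show ?thesis using B(2) False by (simp add: std_def)
            qed (use B(4) in auto)
            then have "det B = (\<Prod>i\<in>UNIV. B $ i $ i)" by (intro det_diagonal) auto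
            also have "\<dots> = (\<Prod>i\<in>UNIV. if i = j then B $ j $ j else 1)"
              using entries by (intro prod.cong) auto
            finally have "B $ j $ j = 1" using B(1) by simp
            then have "B $ i $ l = (if i = l then 1 else 0)" for i l
              using entries[of i l] by (cases "i = l"; cases "l = j") simp_all
            then have "B = mat 1" by (simp add: vec_eq_iff mat_def)
            then show "linear_pmap B \<in> N" using N.one_closed by (simp add: linear_pmap_1)
          qed
        qed
      qed
    qed
  qed
  from this[of _ "{}"] show ?thesis by (auto simp: SL_def std_def)
qed

theorem commuting_imp_SL_subset:
  assumes "card (UNIV :: 'n set) \<ge> 2" "x \<in> N" "x \<noteq> Var" "u j \<noteq> 0"
    and "\<And>P. dirderiv u (act P x) = act (dirderiv u P) x"
  shows "SL \<subseteq> N"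
proof -
  obtain c where "c \<noteq> 0" "translation (\<lambda>i. c * u i) \<in> N"
    using commuting_imp_shear[OF assms(2-)] shear_imp_translation by blast
  then show ?thesis
    using assms(4) translation_imp_SL_subset[OF assms(1), of "\<lambda>i. c * u i" j] by simp
qed

end

subsection \<open>Automorphisms intertwining directional derivatives\<close>

text \<open>Infinitesimal form of the statement that \<open>x\<close> conjugates the translations
  along \<open>u\<close> to those along \<open>w\<close>; \<open>intertwines_iff_translation\<close>
  relates the two.\<close>

definition intertwines :: "('n::finite \<Rightarrow> 'k::comm_ring_1) \<Rightarrow> ('n \<Rightarrow> 'k) \<Rightarrow> ('n, 'k) pmap \<Rightarrow> bool" where
  "intertwines u w x \<longleftrightarrow> (\<forall>P. dirderiv u (act P x) = act (dirderiv w P) x)"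

lemma intertwinesD: "intertwines u w x \<Longrightarrow> dirderiv u (act P x) = act (dirderiv w P) x"
  by (simp add: intertwines_def)

lemma intertwines_mult:
  "intertwines w z x \<Longrightarrow> intertwines u w y \<Longrightarrow> intertwines u z (x \<otimes>\<^bsub>SA\<^esub> y)"
  by (simp add: intertwines_def act_act[symmetric])

lemma act_inv_SA:
  fixes x :: "('n::finite, 'k::comm_ring_1) pmap"
  assumes "x \<in> carrier SA"
  shows "act (act P x) (inv\<^bsub>SA\<^esub> x) = P" "act (act P (inv\<^bsub>SA\<^esub> x)) x = P"
proof -
  interpret group "SA :: ('n, 'k) pmap monoid" by (rule group_SA)
  show "act (act P x) (inv\<^bsub>SA\<^esub> x) = P" "act (act P (inv\<^bsub>SA\<^esub> x)) x = P"
    using r_inv[OF assms] l_inv[OF assms] by (simp_all add: act_act)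
qed

lemma intertwines_inv:
  assumes "intertwines u w x" "x \<in> carrier SA"
  shows "intertwines w u (inv\<^bsub>SA\<^esub> x)"
  unfolding intertwines_def
proof
  fix P
  have "dirderiv u P = act (dirderiv w (act P (inv\<^bsub>SA\<^esub> x))) x"
    using intertwinesD[OF assms(1), of "act P (inv\<^bsub>SA\<^esub> x)"] by (simp add: act_inv_SA assms)
  then show "dirderiv w (act P (inv\<^bsub>SA\<^esub> x)) = act (dirderiv u P) (inv\<^bsub>SA\<^esub> x)"
    by (simp add: act_inv_SA assms)
qed

lemma intertwines_flow_map:
  assumes "lnd D" "\<And>P. D (dirderiv u P) = dirderiv u (D P)" "dirderiv u F = 0"
  shows "intertwines u u (flow_map D F)"
  using assms by (simp add: intertwines_def act_flow_map flow_derivation derivation_dirderiv)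

lemma intertwines_translation: "intertwines u u (translation w)"
  unfolding translation_def
  by (rule intertwines_flow_map)
    (simp_all add: lnd_dirderiv dirderiv_commute derivationD[OF derivation_dirderiv])

lemma intertwines_iff_translation:
  fixes x :: "('n::{finite,linorder}, 'k::field_char_0) pmap"
  shows "intertwines u w x \<longleftrightarrow>
    (\<forall>c. x \<otimes>\<^bsub>SA\<^esub> translation (\<lambda>i. c * u i) = translation (\<lambda>i. c * w i) \<otimes>\<^bsub>SA\<^esub> x)"
proof
  assume "intertwines u w x"
  then show "\<forall>c. x \<otimes>\<^bsub>SA\<^esub> translation (\<lambda>i. c * u i) = translation (\<lambda>i. c * w i) \<otimes>\<^bsub>SA\<^esub> x"
    using flow_map_intertwine[of "dirderiv u" "dirderiv w" x "Const _"]
    by (simp add: intertwines_def lnd_dirderiv flow_dirderiv_Const[symmetric])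
next
  assume eq: "\<forall>c. x \<otimes>\<^bsub>SA\<^esub> translation (\<lambda>i. c * u i) = translation (\<lambda>i. c * w i) \<otimes>\<^bsub>SA\<^esub> x"
  have "1 * dirderiv u (act P x) = act (1 * dirderiv w P) x" for P
  proof (rule flow_intertwine_conv[OF lnd_dirderiv lnd_dirderiv])
    fix c P
    have "act P (x \<otimes>\<^bsub>SA\<^esub> translation (\<lambda>i. c * u i)) = act P (translation (\<lambda>i. c * w i) \<otimes>\<^bsub>SA\<^esub> x)"
      using eq by simp
    then have "act (act P x) (translation (\<lambda>i. c * u i)) = act (act P (translation (\<lambda>i. c * w i))) x"
      by (simp only: mult_SA act_act)
    then show "flow (dirderiv u) (Const c * 1) (act P x) = act (flow (dirderiv w) (Const c * 1) P) x"
      by (simp only: flow_dirderiv_Const[symmetric] act_flow_map lnd_dirderiv mult_1_right)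
  qed (simp_all add: act_simps)
  then show "intertwines u w x" by (simp add: intertwines_def)
qed

lemma dirderiv_linear: "dirderiv (\<lambda>i. c * u i + w i) P = Const c * dirderiv u P + dirderiv w P"
  by (simp add: dirderiv_def Const_add Const_mult distrib_right sum.distrib sum_distrib_left mult.assoc)

lemma dirderiv_scale: "dirderiv (\<lambda>i. c * u i) P = Const c * dirderiv u P"
  by (simp add: dirderiv_def Const_mult sum_distrib_left mult.assoc)

text \<open>Integration by parts against the local slice \<open>X\<close>. As \<open>s = D X\<close>
  is in the kernel, \<open>D (X^(k+1) P) = (k+1) s X^k P + X^(k+1) D P\<close> trades
  \<open>P\<close> for \<open>D P\<close>, which dies one step earlier; each round costs a factor
  \<open>s\<close> and raises \<open>k\<close>, whence the factor \<open>X^k\<close> in the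
  induction.\<close>

lemma local_slice_antiderivative:
  fixes D :: "('n, 'k::field_char_0) mpoly \<Rightarrow> ('n, 'k) mpoly"
  assumes D: "lnd D" and slice: "D (D X) = 0" and XS: "X \<in> polys_in S"
    and closed: "\<And>P. P \<in> polys_in S \<Longrightarrow> D P \<in> polys_in S" and P: "P \<in> polys_in S"
  shows "\<exists>m. \<exists>Q \<in> polys_in S. D Q = D X ^ m * P"
proof -
  note der = lnd_derivation[OF D]
  have "\<exists>m. \<exists>Q \<in> polys_in S. D Q = D X ^ m * (X ^ k * P)" if "P \<in> polys_in S" "(D ^^ r) P = 0" for r k P
    using that
  proof (induction r arbitrary: k P)
    case 0
    then show ?case by (intro exI[of _ 0] bexI[of _ 0]) (simp_all add: derivationD[OF der])
  next
    case (Suc r)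
    from Suc.prems have "(D ^^ r) (D P) = 0" by (simp add: funpow_swap1)
    from Suc.IH[OF closed[OF Suc.prems(1)] this, of "Suc k"] obtain m Q where
      Q: "Q \<in> polys_in S" "D Q = D X ^ m * (X ^ Suc k * D P)" by blast
    let ?R = "D X ^ m * (X ^ Suc k * P) - Q"
    have "D ?R = D X ^ m * (D (X ^ Suc k) * P)"
      by (simp only: derivationD[OF der] derivation_power_eq_0[OF der slice] Q(2)) (simp add: algebra_simps)
    also have "D (X ^ Suc k) = Const (of_nat (Suc k)) * (X ^ k * D X)"
      by (simp only: derivation_power[OF der] Const_of_nat mult.assoc)
    finally have "D (Const (inverse (of_nat (Suc k))) * ?R) =
        Const (inverse (of_nat (Suc k))) * Const (of_nat (Suc k)) * (D X ^ Suc m * (X ^ k * P))"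
      by (simp only: derivationD(2)[OF der] mult_ac power_Suc)
    then have "D (Const (inverse (of_nat (Suc k))) * ?R) = D X ^ Suc m * (X ^ k * P)"
      by (simp add: Const_mult[symmetric] del: of_nat_Suc power_Suc)
    moreover have "?R \<in> polys_in S"
      by (intro polys_in_intros closed XS Q Suc.prems)
    ultimately show ?case by (intro exI[of _ "Suc m"] bexI[of _ "Const (inverse (of_nat (Suc k))) * ?R"]) (auto intro: polys_in_intros)
  qed
  moreover obtain r where "(D ^^ r) P = 0" using D unfolding lnd_def by blast
  ultimately have "\<exists>m. \<exists>Q \<in> polys_in S. D Q = D X ^ m * (X ^ 0 * P)" using P by blast
  then show ?thesis by simp
qed

text \<open>\<open>D (Var i)\<close> involves earlier variables only, where nilpotency is known by
  induction.\<close>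

lemma triangular_derivation_lnd:
  fixes D :: "('n::{finite,linorder}, 'k::comm_ring_1) mpoly \<Rightarrow> ('n, 'k) mpoly"
  assumes "triangular_derivation D" shows "lnd D"
proof (rule lndI)
  show der: "derivation D" using assms by (simp add: triangular_derivation_def)
  fix i
  show "\<exists>k. (D ^^ k) (Var i) = 0"
  proof (induction i rule: finite_less_induct)
    case (less i)
    have "D (Var i) \<in> polys_in {..<i}" using assms by (simp add: triangular_derivation_def)
    from derivation_nilpotent_on[OF der this] less obtain k where "(D ^^ k) (D (Var i)) = 0" by auto
    then have "(D ^^ Suc k) (Var i) = 0" by (simp add: funpow_swap1)
    then show ?case by blast
  qed
qed

lemma triangular_derivation_polys_in:
  assumes "triangular_derivation D" "P \<in> polys_in {..<j}"
  shows "D P \<in> polys_in {..<j}"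
proof -
  have der: "derivation D" using assms(1) by (simp add: triangular_derivation_def)
  have "P \<in> polys_in {..<j} \<and> D P \<in> polys_in {..<j}"
    using assms(2)
  proof (induction P rule: polys_in_induct)
    case (Var i)
    then have "polys_in {..<i} \<subseteq> polys_in {..<j}" by (intro polys_in_mono) auto
    then show ?case using assms(1) Var by (auto simp: triangular_derivation_def intro: polys_in_Var)
  qed (auto simp: derivationD[OF der] intro: polys_in_intros)
  then show ?thesis ..
qed

subsection \<open>Commutators with a triangular flow\<close>

context normal_subgroup_SA
begin

lemma cancel_left:
  fixes a b :: "('n, 'k) pmap"
  assumes "a \<in> carrier SA" "b \<in> carrier SA"
  shows "inv\<^bsub>SA\<^esub> a \<otimes>\<^bsub>SA\<^esub> (a \<otimes>\<^bsub>SA\<^esub> b) = b" "a \<otimes>\<^bsub>SA\<^esub> (inv\<^bsub>SA\<^esub> a \<otimes>\<^bsub>SA\<^esub> b) = b"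
proof -
  note [simp del] = mult_SA one_SA
  show "inv\<^bsub>SA\<^esub> a \<otimes>\<^bsub>SA\<^esub> (a \<otimes>\<^bsub>SA\<^esub> b) = b" "a \<otimes>\<^bsub>SA\<^esub> (inv\<^bsub>SA\<^esub> a \<otimes>\<^bsub>SA\<^esub> b) = b"
    using assms by (simp_all add: SA.m_assoc[symmetric])
qed

text \<open>As \<open>r\<close> commutes with \<open>e\<close>, its commutator with
  \<open>b e\<close> is \<open>b r b^-1 r^-1\<close>; conjugating this by \<open>b\<close> gives the
  first element \<open>z\<close>. In the second part \<open>z s = r s r^-1 z\<close>, so
  \<open>z\<close> and \<open>r\<close> have the same commutator with \<open>s\<close>.\<close>

lemma commutator_lemma:
  assumes "b \<in> carrier SA" "e \<in> carrier SA" "r \<in> carrier SA" "s \<in> carrier SA" "t \<in> carrier SA"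
    and be: "b \<otimes>\<^bsub>SA\<^esub> e \<in> N" and re: "r \<otimes>\<^bsub>SA\<^esub> e = e \<otimes>\<^bsub>SA\<^esub> r"
  shows "r \<otimes>\<^bsub>SA\<^esub> inv\<^bsub>SA\<^esub> b \<otimes>\<^bsub>SA\<^esub> inv\<^bsub>SA\<^esub> r \<otimes>\<^bsub>SA\<^esub> b \<in> N"
    and "b \<otimes>\<^bsub>SA\<^esub> s = t \<otimes>\<^bsub>SA\<^esub> b \<Longrightarrow> r \<otimes>\<^bsub>SA\<^esub> t = t \<otimes>\<^bsub>SA\<^esub> r \<Longrightarrow> r \<otimes>\<^bsub>SA\<^esub> s \<otimes>\<^bsub>SA\<^esub> inv\<^bsub>SA\<^esub> r \<otimes>\<^bsub>SA\<^esub> inv\<^bsub>SA\<^esub> s \<in> N"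
proof -
  note [simp del] = mult_SA one_SA
  note [simp] = assms(1-5)
  note [simp] = SA.m_assoc cancel_left
  have ext: "x \<otimes>\<^bsub>SA\<^esub> (y \<otimes>\<^bsub>SA\<^esub> w) = x' \<otimes>\<^bsub>SA\<^esub> (y' \<otimes>\<^bsub>SA\<^esub> w)" if "x \<otimes>\<^bsub>SA\<^esub> y = x' \<otimes>\<^bsub>SA\<^esub> y'"
    "x \<in> carrier SA" "y \<in> carrier SA" "x' \<in> carrier SA" "y' \<in> carrier SA" "w \<in> carrier SA" for x y x' y' w :: "('n, 'k) pmap"
    using that by (simp del: SA.m_assoc add: SA.m_assoc[symmetric])
  let ?y = "b \<otimes>\<^bsub>SA\<^esub> r \<otimes>\<^bsub>SA\<^esub> inv\<^bsub>SA\<^esub> b \<otimes>\<^bsub>SA\<^esub> inv\<^bsub>SA\<^esub> r"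
  let ?z = "r \<otimes>\<^bsub>SA\<^esub> inv\<^bsub>SA\<^esub> b \<otimes>\<^bsub>SA\<^esub> inv\<^bsub>SA\<^esub> r \<otimes>\<^bsub>SA\<^esub> b"
  have "b \<otimes>\<^bsub>SA\<^esub> e \<otimes>\<^bsub>SA\<^esub> r = b \<otimes>\<^bsub>SA\<^esub> r \<otimes>\<^bsub>SA\<^esub> inv\<^bsub>SA\<^esub> b \<otimes>\<^bsub>SA\<^esub> (b \<otimes>\<^bsub>SA\<^esub> e)"
    by (simp add: re)
  from conj_quotient[OF be _ _ this] have "?y \<in> N" by simp
  from conj_cancel[OF this, of b ?z] show z: "?z \<in> N" by simp
  assume bs: "b \<otimes>\<^bsub>SA\<^esub> s = t \<otimes>\<^bsub>SA\<^esub> b" and rt: "r \<otimes>\<^bsub>SA\<^esub> t = t \<otimes>\<^bsub>SA\<^esub> r"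
  have "t = b \<otimes>\<^bsub>SA\<^esub> s \<otimes>\<^bsub>SA\<^esub> inv\<^bsub>SA\<^esub> b" unfolding bs by simp
  then have 1: "inv\<^bsub>SA\<^esub> b \<otimes>\<^bsub>SA\<^esub> t = s \<otimes>\<^bsub>SA\<^esub> inv\<^bsub>SA\<^esub> b" by simp
  have "inv\<^bsub>SA\<^esub> r \<otimes>\<^bsub>SA\<^esub> (r \<otimes>\<^bsub>SA\<^esub> t) \<otimes>\<^bsub>SA\<^esub> inv\<^bsub>SA\<^esub> r = inv\<^bsub>SA\<^esub> r \<otimes>\<^bsub>SA\<^esub> (t \<otimes>\<^bsub>SA\<^esub> r) \<otimes>\<^bsub>SA\<^esub> inv\<^bsub>SA\<^esub> r"
    by (simp only: rt)
  then have 2: "inv\<^bsub>SA\<^esub> r \<otimes>\<^bsub>SA\<^esub> t = t \<otimes>\<^bsub>SA\<^esub> inv\<^bsub>SA\<^esub> r" by simp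
  have "?z \<otimes>\<^bsub>SA\<^esub> s = r \<otimes>\<^bsub>SA\<^esub> s \<otimes>\<^bsub>SA\<^esub> inv\<^bsub>SA\<^esub> r \<otimes>\<^bsub>SA\<^esub> ?z"
    by (simp add: bs ext[OF 1] ext[OF 2])
  from conj_quotient[OF z _ _ this]
  show "r \<otimes>\<^bsub>SA\<^esub> s \<otimes>\<^bsub>SA\<^esub> inv\<^bsub>SA\<^esub> r \<otimes>\<^bsub>SA\<^esub> inv\<^bsub>SA\<^esub> s \<in> N" by simp
qed

lemma commute_if_commutator:
  assumes "a \<in> carrier SA" "b \<in> carrier SA" "a \<otimes>\<^bsub>SA\<^esub> b \<otimes>\<^bsub>SA\<^esub> inv\<^bsub>SA\<^esub> a \<otimes>\<^bsub>SA\<^esub> inv\<^bsub>SA\<^esub> b = \<one>\<^bsub>SA\<^esub>"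
  shows "a \<otimes>\<^bsub>SA\<^esub> b = b \<otimes>\<^bsub>SA\<^esub> (a :: ('n, 'k) pmap)"
proof -
  note [simp del] = mult_SA one_SA
  have "a \<otimes>\<^bsub>SA\<^esub> b \<otimes>\<^bsub>SA\<^esub> inv\<^bsub>SA\<^esub> a \<otimes>\<^bsub>SA\<^esub> inv\<^bsub>SA\<^esub> b \<otimes>\<^bsub>SA\<^esub> (b \<otimes>\<^bsub>SA\<^esub> a) = b \<otimes>\<^bsub>SA\<^esub> a"
    unfolding assms(3) using assms(1,2) by simp
  then show ?thesis using assms(1,2) by (simp add: SA.m_assoc cancel_left)
qed

lemma commute_inv:
  assumes "a \<in> carrier SA" "b \<in> carrier SA" "a \<otimes>\<^bsub>SA\<^esub> inv\<^bsub>SA\<^esub> b = inv\<^bsub>SA\<^esub> b \<otimes>\<^bsub>SA\<^esub> a"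
  shows "a \<otimes>\<^bsub>SA\<^esub> b = b \<otimes>\<^bsub>SA\<^esub> (a :: ('n, 'k) pmap)"
proof -
  note [simp del] = mult_SA one_SA
  have "b \<otimes>\<^bsub>SA\<^esub> (a \<otimes>\<^bsub>SA\<^esub> inv\<^bsub>SA\<^esub> b) \<otimes>\<^bsub>SA\<^esub> b = b \<otimes>\<^bsub>SA\<^esub> (inv\<^bsub>SA\<^esub> b \<otimes>\<^bsub>SA\<^esub> a) \<otimes>\<^bsub>SA\<^esub> b"
    by (simp only: assms(3))
  then show ?thesis using assms(1,2) by (simp add: SA.m_assoc cancel_left)
qed

text \<open>The case of parallel \<open>v\<close> and \<open>e_n\<close> in step (3) of the idea.
  The induction is on the order \<open>m\<close> at which derivatives of \<open>F\<close> along
  \<open>e\<close> vanish, and shows that the product commutes with the translations along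
  \<open>e\<close>.\<close>

lemma normalizing_flow_eq_Var:
  fixes D :: "('n, 'k) mpoly \<Rightarrow> ('n, 'k) mpoly" and b :: "('n, 'k) pmap"
  assumes trivial: "\<And>x. x \<in> N \<Longrightarrow> intertwines e e x \<Longrightarrow> x = Var"
    and ej: "e j \<noteq> 0" and D: "lnd D" and comm: "\<And>P. D (dirderiv e P) = dirderiv e (D P)"
    and b: "b \<in> carrier SA" "\<kappa> \<noteq> 0" "intertwines (\<lambda>i. \<kappa> * e i) e b"
    and F: "D F = 0" "(dirderiv e ^^ m) F = 0" and N: "b \<otimes>\<^bsub>SA\<^esub> flow_map D F \<in> N"
  shows "b \<otimes>\<^bsub>SA\<^esub> flow_map D F = Var"
  using b F N
proof (induction m arbitrary: b \<kappa> F)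
  case 0
  then have bN: "b \<in> N" and b_eq: "b \<otimes>\<^bsub>SA\<^esub> flow_map D F = b" by (simp_all add: D)
  \<comment> \<open>Here \<open>F = 0\<close>, so \<open>b\<close> lies in \<open>N\<close>. Its
    commutator with a translation is the translation by \<open>(1 - \<kappa>) e\<close>, which must
    be trivial.\<close>
  have "translation (\<lambda>i. 1 * e i) \<otimes>\<^bsub>SA\<^esub> inv\<^bsub>SA\<^esub> translation (\<lambda>i. 1 * (\<kappa> * e i)) \<in> N"
    using 0 unfolding intertwines_iff_translation
    by (intro conj_quotient[OF bN] translation_SA) blast
  then have "translation (\<lambda>i. e i + - (\<kappa> * e i)) \<in> N"
    by (simp only: inv_translation mult_SA translation_mult mult_1)
  then have "translation (\<lambda>i. e i + - (\<kappa> * e i)) = Var"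
    by (rule trivial) (rule intertwines_translation)
  from fun_cong[OF this, of j] have "\<kappa> = 1"
    using ej by (simp add: translation_eq)
  then have "b = Var" using 0(3) by (intro trivial[OF bN]) simp
  then show ?case unfolding b_eq .
next
  case (Suc m)
  let ?f = "flow_map D F" let ?\<psi> = "b \<otimes>\<^bsub>SA\<^esub> ?f"
  have f: "?f \<in> carrier SA" using D Suc.prems by (intro flow_map_SA)
  have "?\<psi> \<otimes>\<^bsub>SA\<^esub> translation (\<lambda>i. c * (\<kappa> * e i)) = translation (\<lambda>i. c * (\<kappa> * e i)) \<otimes>\<^bsub>SA\<^esub> ?\<psi>" for c
  proof -
    define T where "T = translation (\<lambda>i. c * (\<kappa> * e i))"
    define F' where "F' = act F T"
    define f' where "f' = flow_map D F'"
    have T: "T \<in> carrier SA" unfolding T_def by (rule translation_SA)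
    have T_flow: "T = flow_map (dirderiv e) (Const (c * \<kappa>))"
      by (simp add: T_def flow_dirderiv_Const mult.assoc)
    have F'_eq: "F' = flow (dirderiv e) (Const (c * \<kappa>)) F"
      by (simp add: F'_def T_flow act_flow_map lnd_dirderiv)
    have DT: "D (act P T) = act (D P) T" for P
      unfolding T_flow act_flow_map[OF lnd_dirderiv]
      by (rule flow_derivation) (simp_all add: lnd_dirderiv lnd_derivation[OF D] derivationD(4)[OF lnd_derivation[OF D]] comm)
    have DF': "D F' = 0" by (simp add: F'_def DT Suc.prems)
    have f': "f' \<in> carrier SA" unfolding f'_def using D DF' by (intro flow_map_SA)
    have fT: "?f \<otimes>\<^bsub>SA\<^esub> T = T \<otimes>\<^bsub>SA\<^esub> f'"
      unfolding f'_def F'_def mult_SA by (rule flow_map_intertwine[OF D D DT, symmetric])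
    \<comment> \<open>Since \<open>b\<close> only rescales translations along \<open>e\<close>,
      conjugating it by \<open>T\<close> merely adds a translation \<open>B\<close>.\<close>
    define B where "B = translation (\<lambda>i. (c * \<kappa> - c * \<kappa> * \<kappa>) * e i)"
    have B: "B \<in> carrier SA" unfolding B_def by (rule translation_SA)
    have invT: "inv\<^bsub>SA\<^esub> T = translation (\<lambda>i. (- c * \<kappa>) * e i)"
      by (simp add: T_def inv_translation mult.assoc)
    have "inv\<^bsub>SA\<^esub> T \<otimes>\<^bsub>SA\<^esub> b = b \<otimes>\<^bsub>SA\<^esub> translation (\<lambda>i. (- c * \<kappa>) * (\<kappa> * e i))"
      using Suc.prems(3) unfolding invT intertwines_iff_translation by metis
    moreover have "translation (\<lambda>i. (- c * \<kappa>) * (\<kappa> * e i)) \<otimes>\<^bsub>SA\<^esub> T = B"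
      by (simp add: B_def T_def translation_mult algebra_simps)
    ultimately have bB: "inv\<^bsub>SA\<^esub> T \<otimes>\<^bsub>SA\<^esub> b \<otimes>\<^bsub>SA\<^esub> T = b \<otimes>\<^bsub>SA\<^esub> B"
      using Suc.prems(1) T translation_SA[of "\<lambda>i. (- c * \<kappa>) * (\<kappa> * e i)"] SA.m_assoc by metis
    note [simp del] = mult_SA one_SA
    note [simp] = SA.m_assoc cancel_left T f f' B Suc.prems(1) SA.inv_mult_group
    \<comment> \<open>A commutator of the product with \<open>T\<close>, conjugated by the flow. It
      will equal \<open>B exp((F' - F) D)\<close>, the same shape with scaling factor 1 and lower
      order along \<open>e\<close>, so the induction hypothesis makes it trivial.\<close>
    have inN: "?f \<otimes>\<^bsub>SA\<^esub> (inv\<^bsub>SA\<^esub> ?\<psi> \<otimes>\<^bsub>SA\<^esub> (inv\<^bsub>SA\<^esub> T \<otimes>\<^bsub>SA\<^esub> ?\<psi> \<otimes>\<^bsub>SA\<^esub> T)) \<otimes>\<^bsub>SA\<^esub> inv\<^bsub>SA\<^esub> ?f \<in> N"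
      using Suc.prems(6) f T by (intro N.inv_op_closed2 N.m_closed[OF N.m_inv_closed] N.inv_op_closed1)
    have "inv\<^bsub>SA\<^esub> T \<otimes>\<^bsub>SA\<^esub> ?\<psi> \<otimes>\<^bsub>SA\<^esub> T = inv\<^bsub>SA\<^esub> T \<otimes>\<^bsub>SA\<^esub> b \<otimes>\<^bsub>SA\<^esub> T \<otimes>\<^bsub>SA\<^esub> f'"
      by (simp add: fT)
    also have "\<dots> = b \<otimes>\<^bsub>SA\<^esub> (B \<otimes>\<^bsub>SA\<^esub> f')" unfolding bB by simp
    finally have conj: "inv\<^bsub>SA\<^esub> T \<otimes>\<^bsub>SA\<^esub> ?\<psi> \<otimes>\<^bsub>SA\<^esub> T = b \<otimes>\<^bsub>SA\<^esub> (B \<otimes>\<^bsub>SA\<^esub> f')" .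
    have ff: "f' \<otimes>\<^bsub>SA\<^esub> inv\<^bsub>SA\<^esub> ?f = flow_map D (F' - F)"
      by (simp add: f'_def inv_flow_map[OF D Suc.prems(4)] mult_SA flow_map_mult[OF D DF'])
    have "B \<otimes>\<^bsub>SA\<^esub> flow_map D (F' - F) \<in> N"
      using inN unfolding conj ff[symmetric] by simp
    moreover have "intertwines (\<lambda>i. 1 * e i) e B"
      unfolding B_def by (simp add: intertwines_translation)
    moreover have "D (F' - F) = 0"
      by (simp add: derivationD[OF lnd_derivation[OF D]] DF' Suc.prems)
    moreover have "(dirderiv e ^^ m) (F' - F) = 0"
    proof -
      have diff: "(dirderiv e ^^ r) (P - Q) = (dirderiv e ^^ r) P - (dirderiv e ^^ r) Q" for r P Q
        by (induction r) (simp_all add: derivationD[OF derivation_dirderiv])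
      have flow: "(dirderiv e ^^ r) F' = flow (dirderiv e) (Const (c * \<kappa>)) ((dirderiv e ^^ r) F)" for r
        by (induction r) (simp_all add: F'_eq dirderiv_flow_dirderiv)
      show ?thesis using Suc.prems(5) by (simp add: diff flow flow_ker lnd_dirderiv)
    qed
    ultimately have "B \<otimes>\<^bsub>SA\<^esub> flow_map D (F' - F) = \<one>\<^bsub>SA\<^esub>"
      unfolding one_SA by (intro Suc.IH[of B 1]) simp_all
    then have "B \<otimes>\<^bsub>SA\<^esub> f' \<otimes>\<^bsub>SA\<^esub> inv\<^bsub>SA\<^esub> ?f \<otimes>\<^bsub>SA\<^esub> ?f = \<one>\<^bsub>SA\<^esub> \<otimes>\<^bsub>SA\<^esub> ?f" by (simp add: ff)
    then have "B \<otimes>\<^bsub>SA\<^esub> f' = ?f" by simp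
    then have "inv\<^bsub>SA\<^esub> T \<otimes>\<^bsub>SA\<^esub> ?\<psi> \<otimes>\<^bsub>SA\<^esub> T = ?\<psi>" using conj by simp
    then have "T \<otimes>\<^bsub>SA\<^esub> (inv\<^bsub>SA\<^esub> T \<otimes>\<^bsub>SA\<^esub> ?\<psi> \<otimes>\<^bsub>SA\<^esub> T) = T \<otimes>\<^bsub>SA\<^esub> ?\<psi>" by (rule arg_cong)
    then show ?thesis unfolding T_def[symmetric] by simp
  qed
  then have "intertwines (\<lambda>i. \<kappa> * e i) (\<lambda>i. \<kappa> * e i) ?\<psi>"
    unfolding intertwines_iff_translation by blast
  then have "intertwines e e ?\<psi>"
    using Suc.prems(2) by (simp add: intertwines_def dirderiv_scale act_simps)
  then show ?case using trivial Suc.prems(6) by blast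
qed

text \<open>Steps (2) and (3) of the idea, by contradiction: if \<open>SL\<close> is not inside
  \<open>N\<close>, then by step (1) every element of \<open>N\<close> that commutes with the
  translations along a nonzero vector is trivial.\<close>

lemma triangular_flow_imp_SL_subset:
  fixes D :: "('n, 'k) mpoly \<Rightarrow> ('n, 'k) mpoly" and F :: "('n, 'k) mpoly" and \<beta> :: "('n, 'k) pmap"
  defines "n \<equiv> Max UNIV"
  defines "e \<equiv> \<lambda>i. if i = n then 1 else 0"
  assumes card: "card (UNIV :: 'n set) \<ge> 2"
    and tri: "triangular_derivation D" and D0: "D \<noteq> (\<lambda>P. 0)" and DF: "D F = 0"
    and \<beta>: "\<beta> \<in> carrier SA" and \<beta>v: "intertwines v e \<beta>"
    and \<theta>N: "\<beta> \<otimes>\<^bsub>SA\<^esub> flow_map D F \<in> N" and \<theta>1: "\<beta> \<otimes>\<^bsub>SA\<^esub> flow_map D F \<noteq> Var"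
  shows "SL \<subseteq> N"
proof (rule ccontr)
  assume notSL: "\<not> SL \<subseteq> N"
  have trivial: "x = Var" if "x \<in> N" "intertwines u u x" "u j \<noteq> 0" for x u j
    using commuting_imp_SL_subset[of x u j, OF card that(1) _ that(3)] that(2) notSL by (auto simp: intertwines_def)
  have D: "lnd D" by (rule triangular_derivation_lnd[OF tri])
  note der = derivationD[OF lnd_derivation[OF D]]
  note der_dir = derivationD[OF derivation_dirderiv]
  let ?de = "dirderiv e" and ?dv = "dirderiv v"
  have le_n: "j \<le> n" for j unfolding n_def by simp
  have en: "e n = 1" and e0: "j \<noteq> n \<Longrightarrow> e j = 0" for j by (auto simp: e_def)
  have de_lt: "?de P = 0" if "P \<in> polys_in {..<j}" for P j
    by (rule derivation_eq_0I[OF derivation_dirderiv that])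
      (use le_n[of j] in \<open>simp add: e0\<close>)
  have DVar: "D (Var j) \<in> polys_in {..<j}" for j
    using tri by (simp add: triangular_derivation_def)
  \<comment> \<open>Triangularity keeps the last variable out of every \<open>D (Var j)\<close>, so
    both sides vanish on variables.\<close>
  have D_de: "D (?de P) = ?de (D P)" for P
    by (rule derivation_commute_if_Var[OF lnd_derivation[OF D] derivation_dirderiv])
      (simp add: der de_lt[OF DVar])
  obtain P0 where P0: "D P0 \<noteq> 0" using D0 by auto
  have act_eq_0: "act P \<beta> = 0 \<longleftrightarrow> P = 0" for P
    using act_inv_SA(1)[OF \<beta>, of P] by (metis act_0)
  have v_nonzero: "\<exists>j. v j \<noteq> 0"
  proof (rule ccontr)
    assume "\<not> (\<exists>j. v j \<noteq> 0)"
    then have "?dv P = 0" for P by (simp add: dirderiv_def)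
    with intertwinesD[OF \<beta>v, of "Var n"] show False by (simp add: en)
  qed
  then obtain jv where jv: "v jv \<noteq> 0" by blast

  \<comment> \<open>The flows of these \<open>G\<close> commute with \<open>exp(F D)\<close> and
    with the translations along \<open>e\<close>; they are the probes of step (2).\<close>
  let ?A = "{G. D G = 0 \<and> ?de G = 0}"
  have \<rho>: "intertwines v v (flow_map D G)"
    and \<rho>\<beta>: "flow_map D G \<otimes>\<^bsub>SA\<^esub> \<beta> = \<beta> \<otimes>\<^bsub>SA\<^esub> flow_map D G" if "G \<in> ?A" for G
  proof -
    let ?r = "flow_map D G"
    have G: "D G = 0" "?de G = 0" using that by auto
    have r: "?r \<in> carrier SA" using D G by (intro flow_map_SA)
    have \<epsilon>: "flow_map D F \<in> carrier SA" using D DF by (intro flow_map_SA)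
    have r\<epsilon>: "?r \<otimes>\<^bsub>SA\<^esub> flow_map D F = flow_map D F \<otimes>\<^bsub>SA\<^esub> ?r"
      by (simp add: flow_map_mult D DF G add.commute)
    have r_e: "intertwines e e ?r" by (rule intertwines_flow_map[OF D D_de G(2)])
    have "?r \<otimes>\<^bsub>SA\<^esub> translation (\<lambda>i. c * v i) = translation (\<lambda>i. c * v i) \<otimes>\<^bsub>SA\<^esub> ?r" for c
    proof -
      let ?s = "translation (\<lambda>i. c * v i)" and ?t = "translation (\<lambda>i. c * e i)"
      have s: "?s \<in> carrier SA" by (rule translation_SA)
      \<comment> \<open>Every factor of this commutator commutes with the translations along
        \<open>e\<close>, so it will be trivial.\<close>
      have "?r \<otimes>\<^bsub>SA\<^esub> ?s \<otimes>\<^bsub>SA\<^esub> inv\<^bsub>SA\<^esub> ?r \<otimes>\<^bsub>SA\<^esub> inv\<^bsub>SA\<^esub> ?s \<in> N"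
        using \<beta>v r_e unfolding intertwines_iff_translation
        by (intro commutator_lemma(2)[OF \<beta> \<epsilon> r translation_SA translation_SA \<theta>N r\<epsilon>]) blast+
      moreover have "intertwines e e (?r \<otimes>\<^bsub>SA\<^esub> ?s \<otimes>\<^bsub>SA\<^esub> inv\<^bsub>SA\<^esub> ?r \<otimes>\<^bsub>SA\<^esub> inv\<^bsub>SA\<^esub> ?s)"
        by (rule intertwines_mult[OF intertwines_mult[OF intertwines_mult[OF r_e intertwines_translation]
              intertwines_inv[OF r_e r]] intertwines_inv[OF intertwines_translation s]])
      ultimately have "?r \<otimes>\<^bsub>SA\<^esub> ?s \<otimes>\<^bsub>SA\<^esub> inv\<^bsub>SA\<^esub> ?r \<otimes>\<^bsub>SA\<^esub> inv\<^bsub>SA\<^esub> ?s = \<one>\<^bsub>SA\<^esub>"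
        unfolding one_SA using en by (intro trivial[of _ e n]) simp_all
      then show ?thesis using commute_if_commutator[OF r s] by blast
    qed
    then show r_v: "intertwines v v ?r" unfolding intertwines_iff_translation by blast
    let ?x = "?r \<otimes>\<^bsub>SA\<^esub> inv\<^bsub>SA\<^esub> \<beta> \<otimes>\<^bsub>SA\<^esub> inv\<^bsub>SA\<^esub> ?r \<otimes>\<^bsub>SA\<^esub> \<beta>"
    have "?x \<in> N" by (rule commutator_lemma(1)[OF \<beta> \<epsilon> r r r \<theta>N r\<epsilon>])
    \<comment> \<open>The direction \<open>v\<close> is turned into \<open>e\<close> by
      \<open>\<beta>\<close>, kept by the flow, turned back, and kept again.\<close>
    moreover have "intertwines v v ?x"
      by (rule intertwines_mult[OF intertwines_mult[OF intertwines_mult[OF r_v intertwines_inv[OF \<beta>v \<beta>]] intertwines_inv[OF r_e r]] \<beta>v])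
    ultimately have "?x = \<one>\<^bsub>SA\<^esub>" unfolding one_SA using trivial jv by blast
    then have "?r \<otimes>\<^bsub>SA\<^esub> inv\<^bsub>SA\<^esub> \<beta> \<otimes>\<^bsub>SA\<^esub> inv\<^bsub>SA\<^esub> ?r \<otimes>\<^bsub>SA\<^esub> inv\<^bsub>SA\<^esub> (inv\<^bsub>SA\<^esub> \<beta>) = \<one>\<^bsub>SA\<^esub>"
      using SA.inv_inv[OF \<beta>] by simp
    then have "?r \<otimes>\<^bsub>SA\<^esub> inv\<^bsub>SA\<^esub> \<beta> = inv\<^bsub>SA\<^esub> \<beta> \<otimes>\<^bsub>SA\<^esub> ?r"
      using commute_if_commutator[OF r SA.inv_closed[OF \<beta>]] by blast
    then show "?r \<otimes>\<^bsub>SA\<^esub> \<beta> = \<beta> \<otimes>\<^bsub>SA\<^esub> ?r"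
      using commute_inv[OF r \<beta>] by blast
  qed
  have A_scale: "Const c * G \<in> ?A" if "G \<in> ?A" for c G
    using that by (simp add: der der_dir)
  have one_A: "1 \<in> ?A" by (simp add: der der_dir)

  \<comment> \<open>All multiples \<open>c G\<close> are allowed, so the commuting flows may be
    differentiated in \<open>c\<close>. First \<open>G = 1\<close>, then a general \<open>G\<close>
    isolates \<open>dv G\<close>, times \<open>D P0 \<noteq> 0\<close>.\<close>
  have GD_dv: "G * D (?dv P) = ?dv (G * D P)" if "G \<in> ?A" for G P
  proof (rule flow_intertwine_conv[OF D D])
    fix c P
    show "flow D (Const c * G) (?dv P) = ?dv (flow D (Const c * G) P)"
      using intertwinesD[OF \<rho>[OF A_scale[OF that]]] by (simp add: act_flow_map D)
  qed (simp_all add: der_dir)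
  have D_dv: "D (?dv P) = ?dv (D P)" for P
    using GD_dv[OF one_A, of P] by simp
  have dv_A: "?dv G = 0" if "G \<in> ?A" for G
    using GD_dv[OF that, of P0] P0 by (simp add: der_dir D_dv)

  have GD_\<beta>: "G * D (act P \<beta>) = act (G * D P) \<beta>" if "G \<in> ?A" for G P
  proof (rule flow_intertwine_conv[OF D D])
    fix c P
    have "act P (\<beta> \<otimes>\<^bsub>SA\<^esub> flow_map D (Const c * G)) = act P (flow_map D (Const c * G) \<otimes>\<^bsub>SA\<^esub> \<beta>)"
      using \<rho>\<beta>[OF A_scale[OF that], of c] by simp
    then have "act (act P \<beta>) (flow_map D (Const c * G)) = act (act P (flow_map D (Const c * G))) \<beta>"
      by (simp only: mult_SA act_act)
    then show "flow D (Const c * G) (act P \<beta>) = act (flow D (Const c * G) P) \<beta>"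
      by (simp only: act_flow_map[OF D])
  qed (simp_all add: act_simps)
  have D_\<beta>: "D (act P \<beta>) = act (D P) \<beta>" for P
    using GD_\<beta>[OF one_A, of P] by simp
  have \<beta>_A: "act G \<beta> = G" if "G \<in> ?A" for G
    using GD_\<beta>[OF that, of P0] P0 by (simp add: D_\<beta> act_mult act_eq_0)

  \<comment> \<open>A \<open>v\<close> parallel to \<open>e\<close> falls under
    \<open>normalizing_flow_eq_Var\<close>, which would make the product trivial.\<close>
  have v_off: "\<exists>j. j \<noteq> n \<and> v j \<noteq> 0"
  proof (rule ccontr)
    assume "\<not> (\<exists>j. j \<noteq> n \<and> v j \<noteq> 0)"
    then have v: "v = (\<lambda>i. v n * e i)" by (intro ext) (auto simp: e_def)
    then have vn: "v n \<noteq> 0" using jv by (metis mult_zero_left)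
    obtain m where m: "(?de ^^ m) F = 0" using lnd_dirderiv unfolding lnd_def by blast
    have "\<beta> \<otimes>\<^bsub>SA\<^esub> flow_map D F = Var"
    proof (rule normalizing_flow_eq_Var[OF _ _ D D_de \<beta> vn _ DF m \<theta>N])
      show "x = Var" if "x \<in> N" "intertwines e e x" for x using trivial[OF that, of n] en by simp
      show "e n \<noteq> 0" by (simp add: en)
      show "intertwines (\<lambda>i. v n * e i) e \<beta>" using \<beta>v v by simp
    qed
    then show False using \<theta>1 by blast
  qed

  \<comment> \<open>The first variable that \<open>D\<close> moves. Its image \<open>f\<close> uses
    earlier variables only and so is killed by \<open>D\<close>, which makes \<open>Var i\<close> a
    local slice.\<close>
  define i where "i = Min {j. D (Var j) \<noteq> 0}"
  have ex: "{j. D (Var j) \<noteq> 0} \<noteq> {}"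
    using derivation_eq_0I[OF lnd_derivation[OF D] polys_in_UNIV, of P0] P0 by auto
  then have i: "D (Var i) \<noteq> 0" using Min_in[of "{j. D (Var j) \<noteq> 0}"] by (simp add: i_def)
  have below: "D (Var j) = 0" if "j < i" for j
    using that Min_le[of "{j. D (Var j) \<noteq> 0}" j] unfolding i_def by (auto simp: not_le[symmetric])
  define f where "f = D (Var i)"
  have Df: "D f = 0" unfolding f_def
    by (rule derivation_eq_0I[OF lnd_derivation[OF D] DVar]) (simp add: below)
  have fA: "f \<in> ?A" using Df de_lt[OF DVar] by (simp add: f_def)
  have f0: "f \<noteq> 0" using i by (simp add: f_def)
  \<comment> \<open>The variables before \<open>i\<close> belong to \<open>?A\<close>, so
    \<open>dv\<close> kills them.\<close>
  have v_below: "v j = 0" if "j < i" for j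
    using dv_A[of "Var j"] below[OF that] that le_n[of i] by (simp add: e0)
  have i_lt: "i < n"
  proof (rule ccontr)
    assume "\<not> i < n"
    then have "i = n" using le_n[of i] by simp
    moreover obtain j where "j \<noteq> n" "v j \<noteq> 0" using v_off by blast
    ultimately show False using v_below[of j] le_n[of j] by simp
  qed

  \<comment> \<open>\<open>E\<close> kills every \<open>G\<close> in the set above, and each \<open>x\<^sub>j\<close> with \<open>i < j < n\<close> occurs linearly in such a \<open>G\<close>.\<close>
  define E where "E P = Const (v i) * D P - f * ?dv P" for P
  have E: "derivation E"
    unfolding derivation_def E_def by (simp add: der der_dir algebra_simps)
  note derE = derivationD[OF E]
  have E_Var: "E (Var j) = 0" if "j < n" for j
    using that
  proof (induction j rule: finite_less_induct)
    case (less j)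
    consider "j < i" | "j = i" | "i < j" by fastforce
    then show ?case
    proof cases
      case 1
      then show ?thesis by (simp add: E_def below v_below)
    next
      case 2
      then show ?thesis by (simp add: E_def f_def mult.commute)
    next
      case 3
      have E_lt: "E P = 0" if "P \<in> polys_in {..<j}" for P
        by (rule derivation_eq_0I[OF E that]) (use less in auto)
      have DXi: "D (D (Var i)) = 0" using Df by (simp add: f_def)
      have "Var i \<in> polys_in {..<j}" using 3 by (intro polys_in_Var) simp
      from local_slice_antiderivative[OF D DXi this triangular_derivation_polys_in[OF tri] DVar[of j]]
      obtain m Q where Q: "Q \<in> polys_in {..<j}" "D Q = f ^ m * D (Var j)"
        unfolding f_def by blast
      have f_j: "f \<in> polys_in {..<j}"
        using subsetD[OF polys_in_mono DVar[of i], of "{..<j}"] 3 by (simp add: f_def)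
      \<comment> \<open>The antiderivative \<open>Q\<close> corrects \<open>f^m x_j\<close> to an
        element of \<open>?A\<close>. By induction \<open>E\<close> kills \<open>Q\<close> and
        \<open>f^m\<close>, so \<open>f^m E x_j = 0\<close> remains.\<close>
      let ?G = "f ^ m * Var j - Q"
      have "D ?G = 0"
        by (simp add: der Q derivation_power_eq_0[OF lnd_derivation[OF D] Df])
      moreover have "?de ?G = 0"
        using less.prems by (simp add: der_dir de_lt[OF Q(1)] de_lt[OF polys_in_power[OF f_j]] e0)
      ultimately have "?dv ?G = 0" by (intro dv_A) simp
      then have "E ?G = 0" using \<open>D ?G = 0\<close> by (simp add: E_def)
      then have "f ^ m * E (Var j) = 0"
        by (simp add: derE E_lt[OF Q(1)] E_lt[OF polys_in_power[OF f_j]])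
      then show ?thesis using f0 by simp
    qed
  qed
  \<comment> \<open>With \<open>v i = 0\<close>, the vanishing of \<open>E\<close> would read
    \<open>f * v j = 0\<close> for all \<open>j < n\<close>, against \<open>v_off\<close>.\<close>
  have vi: "v i \<noteq> 0"
  proof
    assume 0: "v i = 0"
    obtain j where j: "j \<noteq> n" "v j \<noteq> 0" using v_off by blast
    then have "j < n" using le_n[of j] by simp
    from E_Var[OF this] show False using 0 j f0 by (simp add: E_def)
  qed

  \<comment> \<open>Dividing \<open>E = 0\<close> by \<open>v i\<close> gives
    \<open>D = f' dv\<close> on all variables but the last; \<open>p\<close> is the discrepancy on
    the last one.\<close>
  define f' where "f' = Const (inverse (v i)) * f"
  define p where "p = D (Var n) - f' * Const (v n)"
  have f'A: "f' \<in> ?A" unfolding f'_def by (rule A_scale[OF fA])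
  have f'0: "f' \<noteq> 0" using f0 vi by (simp add: f'_def)
  have D_Var: "D (Var j) = f' * Const (v j)" if "j < n" for j
  proof -
    have "Const (inverse (v i)) * (Const (v i) * D (Var j)) = f' * Const (v j)"
      using E_Var[OF that] by (simp add: E_def f'_def mult.assoc)
    then show ?thesis using vi by (simp add: mult.assoc[symmetric] Const_mult[symmetric])
  qed
  have D_eq: "D P = f' * ?dv P + p * ?de P" for P
  proof (rule derivation_eqI[OF lnd_derivation[OF D] _ polys_in_UNIV])
    show "derivation (\<lambda>P. f' * ?dv P + p * ?de P)"
      unfolding derivation_def by (simp add: der_dir algebra_simps)
    fix j
    show "D (Var j) = f' * ?dv (Var j) + p * ?de (Var j)"
    proof (cases "j = n")
      case True
      then show ?thesis by (simp add: p_def en)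
    next
      case False
      then have "j < n" using le_n[of j] by simp
      then show ?thesis using D_Var False by (simp add: e0)
    qed
  qed
  have dv_f': "?dv f' = 0" and de_f': "?de f' = 0" using dv_A[OF f'A] f'A by auto
  have dv_p: "?dv p = 0"
    using D_dv[of "Var n"] by (simp add: p_def der_dir der dv_f')
  have de_p: "?de p = 0"
    by (simp add: p_def der_dir de_lt[OF DVar] de_f')
  have pA: "p \<in> ?A" using D_eq[of p] by (simp add: dv_p de_p)
  have \<epsilon>v: "intertwines u u (flow_map D F)" if "\<And>P. D (dirderiv u P) = dirderiv u (D P)" "dirderiv u F = 0" for u
    using that by (rule intertwines_flow_map[OF D])
  let ?\<theta> = "\<beta> \<otimes>\<^bsub>SA\<^esub> flow_map D F"

  show False
  proof (cases "p = 0")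
    case True
    \<comment> \<open>Since \<open>D = f' dv\<close>, also \<open>F\<close> is killed by
      \<open>dv\<close>. So \<open>\<theta>\<close> conjugates the translations along
      \<open>v\<close> to those along \<open>e\<close>, and the translation by \<open>e - v\<close>,
      nonzero at \<open>i\<close>, lies in \<open>N\<close>.\<close>
    then have "?dv F = 0" using D_eq[of F] f'0 DF by simp
    then have "intertwines v e ?\<theta>" using \<epsilon>v[OF D_dv] \<beta>v by (blast intro: intertwines_mult)
    then have "translation (\<lambda>i. 1 * e i) \<otimes>\<^bsub>SA\<^esub> inv\<^bsub>SA\<^esub> translation (\<lambda>i. 1 * v i) \<in> N"
      unfolding intertwines_iff_translation
      by (intro conj_quotient[OF \<theta>N] translation_SA) blast
    then have "translation (\<lambda>i. e i + - v i) \<in> N"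
      by (simp only: inv_translation mult_SA translation_mult mult_1)
    then have "translation (\<lambda>i. e i + - v i) = Var"
      using intertwines_translation jv by (rule trivial)
    from fun_cong[OF this, of i] show False
      using vi i_lt by (simp add: translation_eq e0)
  next
    case p0: False
    \<comment> \<open>Chosen so that \<open>f' = p k\<close>: comparing \<open>D\<close> before and
      after \<open>\<beta>\<close> on \<open>Var i\<close>, where \<open>e\<close> vanishes, gives
      \<open>p * de (\<beta> i) = f\<close>.\<close>
    define k where "k = Const (inverse (v i)) * ?de (\<beta> i)"
    have key: "p * ?de (act P \<beta>) = act (D P - f' * ?de P) \<beta>" for P
    proof -
      have "p * ?de (act P \<beta>) = D (act P \<beta>) - f' * ?dv (act P \<beta>)"
        using D_eq[of "act P \<beta>"] by simp
      then show ?thesis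
        by (simp add: D_\<beta> intertwinesD[OF \<beta>v] act_simps \<beta>_A[OF f'A])
    qed
    have "p * ?de (\<beta> i) = f"
      using key[of "Var i"] i_lt \<beta>_A[OF fA] by (simp add: e0 f_def)
    then have f'k: "f' = p * k" by (simp add: f'_def k_def mult_ac)
    have k0: "k \<noteq> 0" using f'0 f'k by auto
    have key2: "?de (act P \<beta>) = k * (act (?dv P) \<beta> - ?dv (act P \<beta>)) + ?dv (act P \<beta>)" for P
    proof -
      have "p * ?de (act P \<beta>) = act (f' * ?dv P + p * ?de P - f' * ?de P) \<beta>"
        using key[of P] D_eq[of P] by simp
      also have "\<dots> = p * (k * (act (?dv P) \<beta> - ?dv (act P \<beta>)) + ?dv (act P \<beta>))"
        by (simp add: act_simps \<beta>_A[OF f'A] \<beta>_A[OF pA] intertwinesD[OF \<beta>v]) (simp add: f'k algebra_simps)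
      finally show ?thesis using p0 by simp
    qed
    \<comment> \<open>\<open>\<beta>\<close> sends \<open>P\<close> to \<open>Var i\<close>; for
      this \<open>P\<close>, \<open>key2\<close> exhibits \<open>k\<close> as a divisor of the
      nonzero constant \<open>v i\<close>.\<close>
    define P where "P = act (Var i) (inv\<^bsub>SA\<^esub> \<beta>)"
    have "act P \<beta> = Var i" unfolding P_def by (rule act_inv_SA[OF \<beta>])
    with key2[of P] have "k * (Const (v i) - act (?dv P) \<beta>) = Const (v i)"
      using i_lt by (simp add: e0 algebra_simps)
    from Const_if_dvd_Const[OF this vi] obtain \<kappa> where \<kappa>: "k = Const \<kappa>" by blast
    \<comment> \<open>Along this direction \<open>D = p d_u\<close>. As \<open>\<beta>\<close>
      commutes with \<open>D\<close> and fixes \<open>p\<close>, cancelling \<open>p\<close> shows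
      that it commutes with \<open>d_u\<close>.\<close>
    define u where "u = (\<lambda>j. \<kappa> * v j + e j)"
    have du: "dirderiv u P = k * ?dv P + ?de P" for P
      unfolding u_def dirderiv_linear \<kappa> ..
    have D_du: "D P = p * dirderiv u P" for P
      unfolding du D_eq f'k by (simp add: algebra_simps)
    have "\<kappa> \<noteq> 0" using k0 \<kappa> by auto
    then have ui: "u i \<noteq> 0" using vi i_lt by (simp add: u_def e0)
    have "p * dirderiv u (act P \<beta>) = p * act (dirderiv u P) \<beta>" for P
      using D_\<beta>[of P] by (simp add: D_du act_mult \<beta>_A[OF pA])
    then have "intertwines u u \<beta>" using p0 by (simp add: intertwines_def)
    moreover have "intertwines u u (flow_map D F)"
    proof (rule \<epsilon>v)
      show "dirderiv u F = 0" using DF D_du[of F] p0 by simp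
      show "D (dirderiv u P) = dirderiv u (D P)" for P
        unfolding du \<kappa> by (simp add: der der_dir D_dv D_de)
    qed
    ultimately have "intertwines u u ?\<theta>" by (blast intro: intertwines_mult)
    then show False using trivial[of _ u i, OF \<theta>N _ ui] \<theta>1 by blast
  qed
qed

end

section \<open>Normal closures and the assembly of the theorem\<close>

lemma (in group) normal_closure_props:
  assumes H: "H \<subseteq> carrier G"
  shows "normal_closure G H \<lhd> G" "H \<subseteq> normal_closure G H"
    "N \<lhd> G \<Longrightarrow> H \<subseteq> N \<Longrightarrow> normal_closure G H \<subseteq> N"
proof -
  let ?C = "{g \<otimes> h \<otimes> inv g | g h. g \<in> carrier G \<and> h \<in> H}"
  have C: "?C \<subseteq> carrier G" using H by auto
  show "normal_closure G H \<lhd> G" unfolding normal_closure_def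
  proof (rule normal_generateI[OF C])
    fix x g assume x: "x \<in> ?C" and g: "g \<in> carrier G"
    then obtain k h where k: "k \<in> carrier G" "h \<in> H" "x = k \<otimes> h \<otimes> inv k" by blast
    then have "g \<otimes> x \<otimes> inv g = (g \<otimes> k) \<otimes> h \<otimes> inv (g \<otimes> k)"
      using g H by (auto simp: m_assoc inv_mult_group subset_iff)
    then show "g \<otimes> x \<otimes> inv g \<in> ?C" using g k by blast
  qed
  show "H \<subseteq> normal_closure G H"
  proof
    fix h assume h: "h \<in> H"
    then have "h = \<one> \<otimes> h \<otimes> inv \<one>" using H by auto
    then have "h \<in> ?C" using h by blast
    then show "h \<in> normal_closure G H" unfolding normal_closure_def by (rule generate.incl)
  qed
  assume N: "N \<lhd> G" "H \<subseteq> N"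
  have "?C \<subseteq> N" using N normal.inv_op_closed2[OF N(1)] by blast
  then show "normal_closure G H \<subseteq> N" unfolding normal_closure_def
    by (rule generate_subgroup_incl) (rule normal_imp_subgroup[OF N(1)])
qed

text \<open>The polynomial parts \<open>P i\<close> never contain the last variable, so
  \<open>\<tau>\<close> only rescales the direction \<open>e\<close>.\<close>

lemma intertwines_BA:
  fixes \<tau> :: "('n::{finite,linorder}, 'k::field) pmap"
  assumes "\<tau> \<in> BA"
  defines "e \<equiv> \<lambda>i. if i = Max UNIV then 1 else 0"
  shows "\<exists>a. a \<noteq> 0 \<and> intertwines e (\<lambda>i. a * e i) \<tau>"
proof -
  obtain a P where a: "a i \<noteq> 0" and P: "P i \<in> polys_in {..<i}" and \<tau>: "\<tau> i = Const (a i) * Var i + P i" for i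
    using assms(1) unfolding BA_def by simp metis
  have "dirderiv e (P i) = 0" for i
    by (rule derivation_eq_0I[OF derivation_dirderiv P]) (auto simp: e_def not_less[symmetric])
  then have "dirderiv e (\<tau> i) = Const (a (Max UNIV) * e i)" for i
    by (simp add: \<tau> derivationD[OF derivation_dirderiv] e_def)
  then have "intertwines e (\<lambda>i. a (Max UNIV) * e i) \<tau>"
    unfolding intertwines_def
    by (intro allI act_intertwine_if_Var[OF derivation_dirderiv derivation_dirderiv]) simp
  then show ?thesis using a by blast
qed

lemma intertwines_GL:
  fixes \<alpha> :: "('n::finite, 'k::field) pmap"
  assumes "\<alpha> \<in> GL"
  shows "\<exists>v. intertwines v w \<alpha>"
proof -
  obtain A where A: "\<alpha> = linear_pmap A" "det A \<noteq> 0" using assms by (auto simp: GL_def)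
  then obtain B where "A ** B = mat 1" by (metis invertible_def invertible_det_nz)
  then have "A *v (B *v (\<chi> i. w i)) = (\<chi> i. w i)" by (simp add: matrix_vector_mul_assoc)
  then have "(\<Sum>j\<in>UNIV. A $ i $ j * (B *v (\<chi> i. w i)) $ j) = w i" for i
    by (simp add: matrix_vector_mult_def[of A] vec_eq_iff)
  then have "intertwines (\<lambda>j. (B *v (\<chi> i. w i)) $ j) w \<alpha>"
    by (simp add: intertwines_def A dirderiv_linear_pmap)
  then show ?thesis by blast
qed

lemma mat_1_if_card_1:
  fixes A :: "'k::comm_ring_1^'n^'n"
  assumes "CARD('n) = 1" "det A = 1"
  shows "A = mat 1"
proof -
  obtain j where j: "(UNIV :: 'n set) = {j}" using assms(1) by (rule card_1_singletonE)
  then have all: "i = j" for i :: 'n by blast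
  have "det A = (\<Prod>i\<in>UNIV. A $ i $ i)" by (intro det_diagonal) (metis all)
  also have "\<dots> = A $ j $ j" unfolding j by simp
  finally have "A $ j $ j = 1" using assms(2) by simp
  then have "A $ i $ l = (if i = l then 1 else 0)" for i l
    using all[of i] all[of l] by simp
  then show ?thesis by (simp add: vec_eq_iff mat_def)
qed

text \<open>The Jacobian condition places \<open>\<theta>\<close> in \<open>SA\<close>, where normal
  co-tameness is defined. From dimension 2 on the identity is excluded, since it generates the
  trivial group while \<open>SL\<close> is not trivial; in dimension 1 \<open>SL\<close> is
  trivial.\<close>

theorem theorem25:
  fixes D :: "('n::{finite,linorder}, 'k::field_char_0) mpoly \<Rightarrow> ('n, 'k) mpoly"
    and F :: "('n, 'k) mpoly"
    and \<tau> \<alpha> \<theta> :: "('n, 'k) pmap"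
  assumes "triangular_derivation D" and "D \<noteq> (\<lambda>P. 0)"
    and "D F = 0"
    and "\<tau> \<in> BA" and "\<alpha> \<in> GL"
    and "\<theta> = \<tau> \<otimes>\<^bsub>GA\<^esub> \<alpha> \<otimes>\<^bsub>GA\<^esub> exp_aut (\<lambda>P. F * D P)"
    and "jac_det \<theta> = 1"
    and "CARD('n) \<ge> 2 \<Longrightarrow> \<theta> \<noteq> \<one>\<^bsub>GA\<^esub>"
  shows "normally_cotame \<theta>"
proof -
  interpret GA: group "GA :: ('n, 'k) pmap monoid" by (rule group_GA)
  interpret SA: group "SA :: ('n, 'k) pmap monoid" by (rule group_SA)
  have D: "lnd D" by (rule triangular_derivation_lnd[OF assms(1)])
  define \<beta> where "\<beta> = \<tau> \<otimes>\<^bsub>SA\<^esub> \<alpha>"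
  have "exp_aut (\<lambda>P. F * D P) = flow_map D F"
    by (simp add: exp_aut_def flow_map_def flow_eq_exp_series[OF D assms(3)])
  then have \<theta>: "\<theta> = \<beta> \<otimes>\<^bsub>SA\<^esub> flow_map D F"
    by (simp add: assms(6) \<beta>_def)
  have "\<alpha> \<in> carrier GA" using assms(5) by (auto simp: GL_def linear_pmap_GA)
  then have \<beta>_GA: "\<beta> \<in> carrier GA"
    using GA.m_closed[OF BA_GA[OF assms(4)]] by (simp add: \<beta>_def)
  have \<epsilon>: "flow_map D F \<in> carrier SA" by (rule flow_map_SA[OF D assms(3)])
  obtain c where "jac_det \<beta> = Const c" using jac_det_GA[OF \<beta>_GA] by blast
  then have "jac_det \<beta> = 1"
    using assms(7) \<epsilon> jac_det_mult[of \<beta> "flow_map D F"] by (simp add: \<theta> carrier_SA_iff)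
  with \<beta>_GA have \<beta>: "\<beta> \<in> carrier SA" by (simp add: carrier_SA_iff)
  then have \<theta>_SA: "\<theta> \<in> carrier SA" unfolding \<theta> using \<epsilon> by (rule SA.m_closed)
  define N where "N = normal_closure SA {\<theta>}"
  have N: "N \<lhd> SA" "\<theta> \<in> N"
    unfolding N_def using SA.normal_closure_props[of "{\<theta>}"] \<theta>_SA by auto
  interpret normal_subgroup_SA N by (rule normal_subgroup_SA.intro[OF N(1)])
  have "SL \<subseteq> N"
  proof (cases "CARD('n) \<ge> 2")
    case True
    let ?e = "\<lambda>i. if i = Max UNIV then 1 else (0::'k)"
    obtain a where a: "a \<noteq> 0" "intertwines ?e (\<lambda>i. a * ?e i) \<tau>"
      using intertwines_BA[OF assms(4)] by blast
    obtain u where "intertwines u ?e \<alpha>" using intertwines_GL[OF assms(5)] by blast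
    then have "intertwines u (\<lambda>i. a * ?e i) \<beta>" unfolding \<beta>_def by (rule intertwines_mult[OF a(2)])
    then have "dirderiv (\<lambda>i. inverse a * u i) (act P \<beta>) = act (dirderiv ?e P) \<beta>" for P
      using a(1) by (simp only: intertwines_def dirderiv_scale act_mult act_Const mult.assoc[symmetric]
          Const_mult[symmetric]) simp
    then have "intertwines (\<lambda>i. inverse a * u i) ?e \<beta>" unfolding intertwines_def by blast
    then show ?thesis
      using True assms(1,2,3,8) \<beta> N(2) unfolding \<theta>
      by (intro triangular_flow_imp_SL_subset) simp_all
  next
    case False
    moreover have "CARD('n) \<noteq> 0" by simp
    ultimately have "CARD('n) = 1" by linarith
    then show ?thesis
      using N.one_closed mat_1_if_card_1 by (fastforce simp: SL_def linear_pmap_1)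
  qed
  moreover have "SL \<subseteq> carrier (SA :: ('n, 'k) pmap monoid)"
    by (auto simp: SL_def carrier_SA_iff linear_pmap_GA jac_det_linear_pmap)
  ultimately have "SLIN \<subseteq> N"
    unfolding SLIN_def using SA.normal_closure_props(3) N(1) by blast
  then show ?thesis unfolding normally_cotame_def N_def using \<theta>_SA by blast
qed

end
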